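(* Let $G\subset[0,1]^n$ be a compact set of positive Lebesgue measure with empty interior and let $b=\{b_m\}_{m\in\mathbb{N}}\subset(0,1)$ satisfy $\lim_{m\to\infty}b_m=0$. Let $G_m:=(2m,0,\dots,0)+G$ for $m\in\mathbb{N}$, and define the weight $w_{G,b}$ on $\mathbb{R}^n$ as follows: for $y=(y_1,\dots,y_n)$ with $y_1\ge0$, $w_{G,b}(y)=b_m$ if $y\in G_m$ for some $m\in\mathbb{N}$ and $w_{G,b}(y)=1$ if $y\notin\bigcup_{m}G_m$; for $y_1<0$, $w_{G,b}(y):=w_{G,b}(-y)$. Then there exists $a\in S(\mathbb{R}^n)$ such that $a\in\mathcal{M}_{L^\infty(\mathbb{R}^n,w_{G,b})}\setminus\mathcal{M}^0_{L^\infty(\mathbb{R}^n,w_{G,b})}$.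
   Context: $L^\infty(\mathbb{R}^n,w)$ is the space of measurable $f$ with $\|f\|_{L^\infty(\mathbb{R}^n,w)}:=\|fw\|_{L^\infty(\mathbb{R}^n)}<\infty$. Fourier transform: $(Fu)(\xi)=\int u(x)e^{-ix\xi}dx$. For a normed function space $X$: $\mathcal{M}_{X}$ is the set of tempered distributions $a\in S'(\mathbb{R}^n)$ with $\sup\{\|F^{-1}aFu\|_{X}/\|u\|_{X}: u\in (S(\mathbb{R}^n)\cap X)\setminus\{0\}\}<\infty$ (Fourier transforms on $S$, $S'$); $\mathcal{M}^0_{X}$ is the set of $a\in L^\infty(\mathbb{R}^n)$ with $\sup\{\|F^{-1}aFu\|_{X}/\|u\|_{X}: u\in (L^2(\mathbb{R}^n)\cap X)\setminus\{0\}\}<\infty$, with $F^{\pm1}$ the Fourier transforms on $L^2(\mathbb{R}^n)$. *)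

theory Defs
  imports "HOL-Analysis.Analysis" "HOL-Probability.Essential_Supremum"
begin

definition partial_dir :: "'n::finite \<Rightarrow> (real^'n \<Rightarrow> complex) \<Rightarrow> real^'n \<Rightarrow> complex" where
  "partial_dir i f x = frechet_derivative f (at x) (axis i 1)"

fun iter_partial :: "'n::finite list \<Rightarrow> (real^'n \<Rightarrow> complex) \<Rightarrow> real^'n \<Rightarrow> complex" where
  "iter_partial [] f = f"
| "iter_partial (i # is) f = partial_dir i (iter_partial is f)"

definition schwartz :: "(real^'n::finite \<Rightarrow> complex) set" where
  "schwartz = {f. (\<forall>is x. iter_partial is f differentiable (at x)) \<and>
      (\<forall>is (k::nat). bounded (range (\<lambda>x. (1 + norm x) ^ k * norm (iter_partial is f x))))}"

definition fourier :: "(real^'n::finite \<Rightarrow> complex) \<Rightarrow> real^'n \<Rightarrow> complex" where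
  "fourier u \<xi> = (\<integral>x. u x * cis (- (x \<bullet> \<xi>)) \<partial>lebesgue)"

definition inv_fourier :: "(real^'n::finite \<Rightarrow> complex) \<Rightarrow> real^'n \<Rightarrow> complex" where
  "inv_fourier g x = complex_of_real ((2 * pi) powr (- real CARD('n))) *
      (\<integral>\<xi>. g \<xi> * cis (x \<bullet> \<xi>) \<partial>lebesgue)"

definition L2 :: "(real^'n::finite \<Rightarrow> complex) set" where
  "L2 = {u. u \<in> borel_measurable lebesgue \<and> integrable lebesgue (\<lambda>x. (norm (u x))\<^sup>2)}"

definition L2_limit_of :: "(real \<Rightarrow> real^'n::finite \<Rightarrow> complex) \<Rightarrow> (real^'n \<Rightarrow> complex) \<Rightarrow> bool" where
  "L2_limit_of h g \<longleftrightarrow> g \<in> L2 \<and>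
     (\<forall>\<^sub>F R in at_top. integrable lebesgue (\<lambda>x. (norm (h R x - g x))\<^sup>2)) \<and>
     ((\<lambda>R. \<integral>x. (norm (h R x - g x))\<^sup>2 \<partial>lebesgue) \<longlongrightarrow> 0) at_top"

definition truncate :: "real \<Rightarrow> (real^'n::finite \<Rightarrow> complex) \<Rightarrow> real^'n \<Rightarrow> complex" where
  "truncate R u x = complex_of_real (indicator (ball 0 R) x) * u x"

definition fourier_L2 :: "(real^'n::finite \<Rightarrow> complex) \<Rightarrow> real^'n \<Rightarrow> complex" where
  "fourier_L2 u = (SOME g. L2_limit_of (\<lambda>R. fourier (truncate R u)) g)"

definition inv_fourier_L2 :: "(real^'n::finite \<Rightarrow> complex) \<Rightarrow> real^'n \<Rightarrow> complex" where
  "inv_fourier_L2 g = (SOME h. L2_limit_of (\<lambda>R. inv_fourier (truncate R g)) h)"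

definition Linf_w_norm :: "(real^'n::finite \<Rightarrow> real) \<Rightarrow> (real^'n \<Rightarrow> complex) \<Rightarrow> ereal" where
  "Linf_w_norm w f = esssup lebesgue (\<lambda>x. ereal (norm (f x * complex_of_real (w x))))"

definition Linf_w :: "(real^'n::finite \<Rightarrow> real) \<Rightarrow> (real^'n \<Rightarrow> complex) set" where
  "Linf_w w = {f. f \<in> borel_measurable lebesgue \<and> Linf_w_norm w f < \<infinity>}"

text \<open>M_X for X = L^inf(R^n,w), for a symbol a that is a function (so that, for u in S,
  F^{-1} a F u is the classical inverse Fourier transform of a * Fu).\<close>
definition mult_Linf_w :: "(real^'n::finite \<Rightarrow> real) \<Rightarrow> (real^'n \<Rightarrow> complex) set" where
  "mult_Linf_w w = {a. \<exists>C::real. \<forall>u \<in> schwartz \<inter> Linf_w w. Linf_w_norm w u \<noteq> 0 \<longrightarrow>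
      Linf_w_norm w (inv_fourier (\<lambda>\<xi>. a \<xi> * fourier u \<xi>)) \<le> ereal C * Linf_w_norm w u}"

definition mult0_Linf_w :: "(real^'n::finite \<Rightarrow> real) \<Rightarrow> (real^'n \<Rightarrow> complex) set" where
  "mult0_Linf_w w = {a. a \<in> borel_measurable lebesgue \<and>
      esssup lebesgue (\<lambda>x. ereal (norm (a x))) < \<infinity> \<and>
      (\<exists>C::real. \<forall>u \<in> L2 \<inter> Linf_w w. Linf_w_norm w u \<noteq> 0 \<longrightarrow>
      Linf_w_norm w (inv_fourier_L2 (\<lambda>\<xi>. a \<xi> * fourier_L2 u \<xi>)) \<le> ereal C * Linf_w_norm w u)}"

text \<open>The weight w_{G,b}. The first coordinate is the least index of the (well-ordered)
  index type. N = {1,2,...}.\<close>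
definition first_idx :: "'n::{finite,wellorder}" where
  "first_idx = (LEAST i. True)"

definition shiftG :: "(real^'n::{finite,wellorder}) set \<Rightarrow> nat \<Rightarrow> (real^'n::{finite,wellorder}) set" where
  "shiftG G m = (\<lambda>x. axis first_idx (2 * real m) + x) ` G"

definition weight_pos :: "(real^'n::{finite,wellorder}) set \<Rightarrow> (nat \<Rightarrow> real) \<Rightarrow> real^'n::{finite,wellorder} \<Rightarrow> real" where
  "weight_pos G b y = (if \<exists>m\<ge>1. y \<in> shiftG G m
      then b (SOME m. m \<ge> 1 \<and> y \<in> shiftG G m) else 1)"

definition weight :: "(real^'n::{finite,wellorder}) set \<Rightarrow> (nat \<Rightarrow> real) \<Rightarrow> real^'n::{finite,wellorder} \<Rightarrow> real" where
  "weight G b y = (if y $ first_idx \<ge> 0 then weight_pos G b y else weight_pos G b (- y))"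

end

theory Submission
  imports Defs "HOL-Probability.Characteristic_Functions" "HOL-Probability.Sinc_Integral"
begin

text \<open>
  The weight equals \<open>1\<close> on a dense open set, so on continuous functions the weighted norm is the
  ordinary sup norm. Hence convolution with the Gaussian, which has the Schwartz symbol
  \<open>a = exp (- |\<xi>|\<^sup>2 / 2)\<close>, is bounded on \<open>S\<close>. For the indicator function \<open>u\<close> of \<open>G\<^sub>m\<close>,
  however, the weighted norm is at most \<open>b\<^sub>m\<close>, whereas the Gaussian average of \<open>u\<close> is bounded
  below, uniformly in \<open>m\<close>, on a ball inside the gap between \<open>G\<^sub>m\<close> and \<open>G\<^sub>m\<^sub>+\<^sub>1\<close>. Since
  \<open>b\<^sub>m \<rightarrow> 0\<close>, no constant works on \<open>L\<^sup>2\<close>. Evaluating the \<open>L\<^sup>2\<close> Fourier transforms on \<open>u\<close>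
  takes only the inequality half of Plancherel's theorem, obtained by Gaussian regularisation.
\<close>

section \<open>Gaussians\<close>

text \<open>The example lives in the gap between "nowhere dense" and "null": a compact set of empty
  interior and positive measure is invisible to the supremum of a continuous function, but not to
  that of an L2 function. An infinite union of nowhere dense sets may be dense; here the copies are
  locally finite, which keeps the set of weight 1 dense. The operators on L2 are
  \<open>SOME\<close>-chosen limits of transforms of truncations, known only almost everywhere.
  Truncation is harmless for the compactly supported \<open>u\<close>. After multiplication by the
  symbol compact support is lost, and the truncation error must be shown to vanish in L2 after the
  inverse transform; this is the purpose of the Plancherel inequality. The Gaussian is chosen
  because its kernel is an explicit positive probability density: an average cannot exceed the
  supremum, and it is bounded below at bounded distance. The parameter of \<open>gauss\<close> is an
  inverse variance, which the transform turns from \<open>t\<close> into \<open>1 / t\<close>: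
  \<open>t = 1\<close> gives symbol and kernel, small \<open>t\<close> a regularising
  weight.\<close>

definition gauss :: "real \<Rightarrow> 'a::euclidean_space \<Rightarrow> real" where
  "gauss t x = exp (- (t * (norm x)\<^sup>2 / 2))"

lemma gauss_pos [simp]: "0 < gauss t x"
  by (simp add: gauss_def)

lemma gauss_nonneg [simp]: "0 \<le> gauss t x"
  by (simp add: gauss_def)

lemma gauss_le_1: "0 \<le> t \<Longrightarrow> gauss t x \<le> 1"
  by (simp add: gauss_def)

lemma gauss_minus [simp]: "gauss t (- x) = gauss t x"
  by (simp add: gauss_def)

lemma continuous_on_gauss [continuous_intros]: "continuous_on A f \<Longrightarrow> continuous_on A (\<lambda>x. gauss t (f x))"
  unfolding gauss_def by (intro continuous_intros) auto

lemma borel_measurable_gauss [measurable]: "gauss t \<in> borel_measurable borel"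
  by (intro borel_measurable_continuous_onI continuous_intros)

lemma borel_measurable_cis [measurable]: "cis \<in> borel_measurable borel"
  by (intro borel_measurable_continuous_onI continuous_intros)

section \<open>Gaussian integrals: one variable, tensor products, translations\<close>

lemma integrable_gauss_real:
  assumes "t > 0" shows "integrable lborel (\<lambda>x::real. exp (- (t * x\<^sup>2 / 2)))"
proof -
  have "exp (- (t * x\<^sup>2 / 2)) = sqrt (2 * pi / t) * normal_density 0 (1 / sqrt t) x" for x
    using assms by (simp add: normal_density_def power_divide real_sqrt_divide real_sqrt_mult field_simps)
  then show ?thesis
    using assms integrable_normal_density[of "1 / sqrt t" 0] by simp
qed

text \<open>Up to a constant this is the characteristic function of the standard normal law;
  replacing \<open>x\<close> by \<open>x / sqrt t\<close> covers every \<open>t > 0\<close>.\<close>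

lemma integral_gauss_cis_real:
  assumes "t > 0"
  shows "(\<integral>x. complex_of_real (exp (- (t * x\<^sup>2 / 2))) * cis (x * r) \<partial>lborel)
    = of_real (sqrt (2 * pi / t) * exp (- (1 / t * r\<^sup>2 / 2)))"
proof -
  have ch: "char std_normal_distribution q = (\<integral>x. std_normal_density x *\<^sub>R iexp (q * x) \<partial>lborel)" for q
    unfolding char_def by (subst integral_density) auto
  have "iexp (q * x) = cis (x * q)" for q x
    by (simp add: cis_conv_exp mult.commute)
  then have de: "std_normal_density x *\<^sub>R iexp (q * x) = complex_of_real (1 / sqrt (2 * pi)) *
      (complex_of_real (exp (- (x\<^sup>2 / 2))) * cis (x * q))" for q x
    by (simp only: std_normal_density_def scaleR_conv_of_real of_real_mult mult.assoc minus_divide_left)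
  have *: "(\<integral>x. complex_of_real (1 / sqrt (2 * pi)) * (complex_of_real (exp (- (x\<^sup>2 / 2))) * cis (x * q)) \<partial>lborel)
      = exp (- (q\<^sup>2 / 2))" for q
    using ch[of q] unfolding char_std_normal_distribution de by (simp only: minus_divide_left)
  have **: "(\<integral>x. (complex_of_real (exp (- (x\<^sup>2 / 2))) * cis (x * q)) \<partial>lborel)
      = of_real (sqrt (2 * pi) * exp (- (q\<^sup>2 / 2)))" for q
    using arg_cong[OF *[of q], of "(*) (complex_of_real (sqrt (2 * pi)))"]
    unfolding integral_mult_right_zero by (simp flip: of_real_mult mult.assoc)
  have "(\<integral>x. complex_of_real (exp (- (t * x\<^sup>2 / 2))) * cis (x * r) \<partial>lborel)
    = (1 / sqrt t) *\<^sub>R (\<integral>x. (complex_of_real (exp (- (x\<^sup>2 / 2))) * cis (x * (r / sqrt t))) \<partial>lborel)"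
    using assms by (subst lborel_integral_real_affine[where c="1 / sqrt t" and t=0])
      (auto simp: power_divide)
  also note **
  also have "(r / sqrt t)\<^sup>2 = 1 / t * r\<^sup>2"
    using assms by (simp add: power_divide)
  also have "(1 / sqrt t) *\<^sub>R complex_of_real (sqrt (2 * pi) * exp (- (1 / t * r\<^sup>2 / 2)))
      = of_real (sqrt (2 * pi / t) * exp (- (1 / t * r\<^sup>2 / 2)))"
    by (simp add: real_sqrt_divide scaleR_conv_of_real)
  finally show ?thesis .
qed

text \<open>\<open>lborel\<close> is the image of a product of one-dimensional Lebesgue measures
  under the coordinate map, so Fubini factors the integral. This lifts to all dimensions both the
  Gaussian integral and, later, an integrable majorant for Schwartz functions.\<close>

lemma
  fixes f :: "'a::euclidean_space \<Rightarrow> real \<Rightarrow> 'b::{real_normed_field,banach,second_countable_topology}"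
  assumes f: "\<And>b. b \<in> Basis \<Longrightarrow> integrable lborel (f b)"
  shows integrable_lborel_prod: "integrable lborel (\<lambda>x. \<Prod>b\<in>Basis. f b (x \<bullet> b))"
    and integral_lborel_prod: "(\<integral>x. (\<Prod>b\<in>Basis. f b (x \<bullet> b)) \<partial>lborel) = (\<Prod>b\<in>Basis. \<integral>x. f b x \<partial>lborel)"
proof -
  interpret product_sigma_finite "\<lambda>_::'a. lborel :: real measure" ..
  have [measurable]: "b \<in> Basis \<Longrightarrow> f b \<in> borel_measurable borel" for b
    using borel_measurable_integrable[OF f] by simp
  have *: "(\<Prod>b\<in>Basis. f b ((\<Sum>c\<in>Basis. g c *\<^sub>R c) \<bullet> b)) = (\<Prod>b\<in>Basis. f b (g b))" for g :: "'a \<Rightarrow> real"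
    by (rule prod.cong) auto
  have m: "(\<lambda>x. \<Prod>b\<in>Basis. f b (x \<bullet> b)) \<in> borel_measurable (borel :: 'a measure)" by measurable
  have d: "(\<lambda>g. \<Sum>b\<in>Basis. g b *\<^sub>R b) \<in> (\<Pi>\<^sub>M b\<in>(Basis::'a set). lborel) \<rightarrow>\<^sub>M borel" by measurable
  show "integrable lborel (\<lambda>x. \<Prod>b\<in>Basis. f b (x \<bullet> b))"
    by (subst lborel_eq, subst integrable_distr_eq[OF d m], unfold *)
       (rule product_integrable_prod[OF finite_Basis f])
  show "(\<integral>x. (\<Prod>b\<in>Basis. f b (x \<bullet> b)) \<partial>lborel) = (\<Prod>b\<in>Basis. \<integral>x. f b x \<partial>lborel)"
    by (subst lborel_eq, subst integral_distr[OF d m], unfold *)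
       (rule product_integral_prod[OF finite_Basis f])
qed

lemma cis_sum: "cis (sum f A) = (\<Prod>x\<in>A. cis (f x))"
  by (induction A rule: infinite_finite_induct) (auto simp: cis_mult[symmetric])

lemma gauss_prod: "gauss t x = (\<Prod>b\<in>Basis. exp (- (t * (x \<bullet> b)\<^sup>2 / 2)))"
  by (simp add: gauss_def power2_norm_eq_inner euclidean_inner[of x x] sum_distrib_left
      sum_divide_distrib flip: exp_sum sum_negf power2_eq_square)

lemma gauss_cis_prod: "complex_of_real (gauss t x) * cis (x \<bullet> y) =
    (\<Prod>b\<in>Basis. complex_of_real (exp (- (t * (x \<bullet> b)\<^sup>2 / 2))) * cis ((x \<bullet> b) * (y \<bullet> b)))"
  by (simp add: gauss_prod euclidean_inner[of x y] cis_sum prod.distrib)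

lemma integrable_gauss_cis:
  assumes "t > 0" shows "integrable lborel (\<lambda>x. complex_of_real (gauss t x) * cis (x \<bullet> y))"
  unfolding gauss_cis_prod
proof (rule integrable_lborel_prod)
  fix b
  show "integrable lborel (\<lambda>x. complex_of_real (exp (- (t * x\<^sup>2 / 2))) * cis (x * (y \<bullet> b)))"
    by (rule Bochner_Integration.integrable_bound[OF integrable_gauss_real[OF assms]]) (auto simp: norm_mult)
qed

lemma integral_gauss_cis:
  fixes y :: "'a::euclidean_space"
  assumes "t > 0"
  shows "(\<integral>x. complex_of_real (gauss t x) * cis (x \<bullet> y) \<partial>lborel)
    = of_real (sqrt (2 * pi / t) ^ DIM('a) * gauss (1 / t) y)"
  unfolding gauss_cis_prod
proof (subst integral_lborel_prod)
  fix b
  show "integrable lborel (\<lambda>x. complex_of_real (exp (- (t * x\<^sup>2 / 2))) * cis (x * (y \<bullet> b)))"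
    by (rule Bochner_Integration.integrable_bound[OF integrable_gauss_real[OF assms]]) (auto simp: norm_mult)
next
  show "(\<Prod>b\<in>Basis. \<integral>x. complex_of_real (exp (- (t * x\<^sup>2 / 2))) * cis (x * (y \<bullet> b)) \<partial>lborel)
    = of_real (sqrt (2 * pi / t) ^ DIM('a) * gauss (1 / t) y)"
    by (simp add: integral_gauss_cis_real[OF assms] prod.distrib gauss_prod del: times_divide_eq_left)
qed

lemma integrable_gauss: "t > 0 \<Longrightarrow> integrable lborel (gauss t)"
  using integrable_gauss_cis[of t 0] by (simp add: complex_of_real_integrable_eq)

lemma integral_gauss:
  "t > 0 \<Longrightarrow> (\<integral>x. gauss t (x::'a::euclidean_space) \<partial>lborel) = sqrt (2 * pi / t) ^ DIM('a)"
  using integral_gauss_cis[of t "0::'a"] unfolding gauss_def[of "1/t"] by (simp flip: of_real_power of_real_mult)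

lemma
  fixes f :: "'a::euclidean_space \<Rightarrow> 'b::{banach,second_countable_topology}"
  assumes "integrable lborel f"
  shows integrable_lborel_plus: "integrable lborel (\<lambda>x. f (c + x))"
    and integral_lborel_plus: "(\<integral>x. f (c + x) \<partial>lborel) = (\<integral>x. f x \<partial>lborel)"
proof -
  have p: "(+) c \<in> lborel \<rightarrow>\<^sub>M borel" by simp
  have f: "f \<in> borel_measurable borel" using assms by (auto dest: borel_measurable_integrable)
  show "integrable lborel (\<lambda>x. f (c + x))"
    using assms integrable_distr_eq[OF p f] by (simp add: lborel_distr_plus)
  show "(\<integral>x. f (c + x) \<partial>lborel) = (\<integral>x. f x \<partial>lborel)"
    using integral_distr[OF p f] by (simp add: lborel_distr_plus)
qed

lemma gauss_diff_eq: "gauss t (x - y) = gauss t (- x + y)"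
  using gauss_minus[of t "x - y"] by simp

lemma
  assumes "t > 0"
  shows integrable_gauss_shift: "integrable lborel (\<lambda>y::'a::euclidean_space. gauss t (x - y))"
    and integral_gauss_shift: "(\<integral>y. gauss t (x - y :: 'a) \<partial>lborel) = sqrt (2 * pi / t) ^ DIM('a)"
  using integrable_lborel_plus[OF integrable_gauss[OF assms], of "- x"]
    integral_lborel_plus[OF integrable_gauss[OF assms], of "- x"] integral_gauss[OF assms, where 'a='a]
  by (simp_all only: gauss_diff_eq[of t x])

section \<open>The Fourier transform of integrable functions\<close>

text \<open>The sign \<open>s\<close> is -1 for the forward transform and 1 for the inverse one
  without its constant, so each estimate is proved once, under \<open>s\<^sup>2 = 1\<close>.
  Integrating over \<open>lborel\<close> makes Fubini available for Borel integrands.\<close>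

definition ft :: "real \<Rightarrow> ('a::euclidean_space \<Rightarrow> complex) \<Rightarrow> 'a \<Rightarrow> complex" where
  "ft s u \<xi> = (\<integral>x. u x * cis (s * (x \<bullet> \<xi>)) \<partial>lborel)"

lemma borel_measurable_cnj [measurable]: "cnj \<in> borel_measurable borel"
  by (intro borel_measurable_continuous_onI continuous_intros)

lemma borel_measurable_ft [measurable]:
  assumes [measurable]: "u \<in> borel_measurable borel"
  shows "ft s u \<in> borel_measurable borel"
proof -
  have "(\<lambda>\<xi>. \<integral>x. u x * cis (s * (x \<bullet> \<xi>)) \<partial>lborel) \<in> borel_measurable borel"
    by measurable
  then show ?thesis by (simp add: ft_def[abs_def])
qed

lemma norm_ft_le: "norm (ft s u \<xi>) \<le> (\<integral>x. norm (u x) \<partial>lborel)"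
  unfolding ft_def using integral_norm_bound[of lborel "\<lambda>x. u x * cis (s * (x \<bullet> \<xi>))"]
  by (simp add: norm_mult)

lemma integrable_mult_cis:
  assumes "integrable lborel u"
  shows "integrable lborel (\<lambda>x. u x * cis (s * (x \<bullet> \<xi>)))"
proof (rule Bochner_Integration.integrable_bound[OF assms])
  have [measurable]: "u \<in> borel_measurable borel" using assms by (auto dest: borel_measurable_integrable)
  show "(\<lambda>x. u x * cis (s * (x \<bullet> \<xi>))) \<in> borel_measurable lborel" by measurable
qed (simp add: norm_mult)

text \<open>Fubini's theorem: the kernel is symmetric in its two variables and has modulus 1, so the
  double integrand has modulus \<open>norm (f x) * norm (g \<xi>)\<close>.\<close>

lemma integral_ft_mult:
  fixes f g :: "'a::euclidean_space \<Rightarrow> complex"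
  assumes f: "integrable lborel f" and g: "integrable lborel g"
  shows "(\<integral>\<xi>. ft s f \<xi> * g \<xi> \<partial>lborel) = (\<integral>x. f x * ft s g x \<partial>lborel)"
proof -
  have [measurable]: "f \<in> borel_measurable borel" "g \<in> borel_measurable borel"
    using f g by (auto dest: borel_measurable_integrable)
  let ?F = "\<lambda>x \<xi>. f x * cis (s * (x \<bullet> \<xi>)) * g \<xi>"
  have "integrable (lborel \<Otimes>\<^sub>M lborel) (case_prod ?F)"
  proof (rule lborel_pair.Fubini_integrable)
    show "case_prod ?F \<in> borel_measurable (lborel \<Otimes>\<^sub>M lborel)" by measurable
    show "integrable lborel (\<lambda>x. \<integral>\<xi>. norm (case (x, \<xi>) of (x, \<xi>) \<Rightarrow> ?F x \<xi>) \<partial>lborel)"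
      using f by (simp add: norm_mult)
    have "integrable lborel (\<lambda>\<xi>. f x * (g \<xi> * cis (s * (\<xi> \<bullet> x))))" for x
      by (intro integrable_mult_right integrable_mult_cis g)
    then show "AE x in lborel. integrable lborel (\<lambda>\<xi>. case (x, \<xi>) of (x, \<xi>) \<Rightarrow> ?F x \<xi>)"
      by (simp add: inner_commute mult_ac)
  qed
  from lborel_pair.Fubini_integral[OF this]
  have "(\<integral>\<xi>. \<integral>x. f x * cis (s * (x \<bullet> \<xi>)) * g \<xi> \<partial>lborel \<partial>lborel)
      = (\<integral>x. \<integral>\<xi>. f x * (g \<xi> * cis (s * (\<xi> \<bullet> x))) \<partial>lborel \<partial>lborel)"
    by (simp only: mult.assoc mult.commute[of "cis _"] inner_commute)
  then show ?thesis
    by (simp only: integral_mult_left_zero integral_mult_right_zero ft_def)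
qed

text \<open>Modulation before the transform is translation after it; the remaining factor
  \<open>s\<close> has modulus 1 and is lost in the radial Gaussian.\<close>

lemma ft_gauss_modulated:
  fixes x y :: "'a::euclidean_space"
  assumes "t > 0" "s\<^sup>2 = 1"
  shows "ft s (\<lambda>\<xi>. gauss t \<xi> * cis (- s * (\<xi> \<bullet> x))) y
    = of_real (sqrt (2 * pi / t) ^ DIM('a) * gauss (1 / t) (x - y))"
proof -
  have "ft s (\<lambda>\<xi>. gauss t \<xi> * cis (- s * (\<xi> \<bullet> x))) y
      = (\<integral>\<xi>. gauss t \<xi> * cis (\<xi> \<bullet> (s *\<^sub>R (y - x))) \<partial>lborel)"
    unfolding ft_def by (simp add: mult.assoc cis_mult inner_diff_right algebra_simps)
  also have "\<dots> = of_real (sqrt (2 * pi / t) ^ DIM('a) * gauss (1 / t) (s *\<^sub>R (y - x)))"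
    by (rule integral_gauss_cis[OF assms(1)])
  also have "gauss (1 / t) (s *\<^sub>R (y - x)) = gauss (1 / t) (x - y)"
    using assms(2) by (simp add: gauss_def power_mult_distrib norm_minus_commute)
  finally show ?thesis .
qed

text \<open>A regularised inversion formula: \<open>integral_ft_mult\<close> moves the transform
  from \<open>u\<close> onto a modulated Gaussian, where it is explicit. The case
  \<open>t = 1\<close> identifies the multiplier operator; general \<open>t\<close> serves the L2
  bound.\<close>

lemma ft_gauss_ft:
  fixes u :: "'a::euclidean_space \<Rightarrow> complex"
  assumes t: "t > 0" and s: "s\<^sup>2 = 1" and u: "integrable lborel u"
  shows "ft (- s) (\<lambda>\<xi>. gauss t \<xi> * ft s u \<xi>) x
    = of_real (sqrt (2 * pi / t) ^ DIM('a)) * (\<integral>y. u y * gauss (1 / t) (x - y) \<partial>lborel)"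
proof -
  have "ft (- s) (\<lambda>\<xi>. gauss t \<xi> * ft s u \<xi>) x
    = (\<integral>\<xi>. ft s u \<xi> * (gauss t \<xi> * cis (- s * (\<xi> \<bullet> x))) \<partial>lborel)"
    unfolding ft_def[of "- s"] by (simp add: mult_ac)
  also have "\<dots> = (\<integral>y. u y * ft s (\<lambda>\<xi>. gauss t \<xi> * cis (- s * (\<xi> \<bullet> x))) y \<partial>lborel)"
  proof (rule integral_ft_mult[OF u])
    show "integrable lborel (\<lambda>\<xi>. complex_of_real (gauss t \<xi>) * cis (- s * (\<xi> \<bullet> x)))"
      using integrable_gauss[OF t] by (intro integrable_mult_cis) (simp add: complex_of_real_integrable_eq)
  qed
  also have "\<dots> = (\<integral>y. of_real (sqrt (2 * pi / t) ^ DIM('a)) * (u y * gauss (1 / t) (x - y)) \<partial>lborel)"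
    unfolding ft_gauss_modulated[OF t s] by (simp add: mult_ac)
  finally show ?thesis by (simp only: integral_mult_right_zero)
qed

section \<open>Schur's test and the Plancherel inequality\<close>

lemma nn_integral_schur_gauss:
  fixes u :: "'a::euclidean_space \<Rightarrow> complex"
  assumes t: "t > 0" and [measurable]: "u \<in> borel_measurable borel"
  shows "(\<integral>\<^sup>+x. \<integral>\<^sup>+y. ennreal (norm (u x) * norm (u y) * gauss t (x - y)) \<partial>lborel \<partial>lborel)
    \<le> ennreal (sqrt (2 * pi / t) ^ DIM('a)) * (\<integral>\<^sup>+x. ennreal ((norm (u x))\<^sup>2) \<partial>lborel)"
proof -
  let ?c = "ennreal (sqrt (2 * pi / t) ^ DIM('a))"
  let ?h = "\<lambda>x. ennreal ((norm (u x))\<^sup>2 / 2)"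
  have g: "(\<integral>\<^sup>+y. ennreal (gauss t (x - y)) \<partial>lborel) = ?c" for x :: 'a
    by (subst nn_integral_eq_integral[OF integrable_gauss_shift[OF t]]) (auto simp: integral_gauss_shift[OF t])
  have g': "(\<integral>\<^sup>+y. ennreal (gauss t (y - x)) \<partial>lborel) = ?c" for x :: 'a
    using g[of x] by (metis (no_types, lifting) gauss_minus minus_diff_eq nn_integral_cong)
  \<comment> \<open>After the inequality between geometric and arithmetic mean, each summand
    involves \<open>u\<close> at one point only; integrating out the other variable leaves the mass
    of the kernel.\<close>
  have "norm (u x) * norm (u y) * gauss t (x - y)
      \<le> ((norm (u x))\<^sup>2 / 2) * gauss t (x - y) + ((norm (u y))\<^sup>2 / 2) * gauss t (x - y)" for x y
  proof -
    have "2 * (norm (u x) * norm (u y)) \<le> (norm (u x))\<^sup>2 + (norm (u y))\<^sup>2"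
      using sum_squares_bound[of "norm (u x)" "norm (u y)"] by simp
    then have "norm (u x) * norm (u y) \<le> (norm (u x))\<^sup>2 / 2 + (norm (u y))\<^sup>2 / 2" by linarith
    from mult_right_mono[OF this, of "gauss t (x - y)"] show ?thesis by (simp add: distrib_right)
  qed
  then have le: "ennreal (norm (u x) * norm (u y) * gauss t (x - y))
      \<le> ?h x * ennreal (gauss t (x - y)) + ?h y * ennreal (gauss t (x - y))" for x y
    by (auto simp add: simp flip: ennreal_mult ennreal_plus intro!: ennreal_leI)
  have "(\<integral>\<^sup>+x. \<integral>\<^sup>+y. ennreal (norm (u x) * norm (u y) * gauss t (x - y)) \<partial>lborel \<partial>lborel)
    \<le> (\<integral>\<^sup>+x. \<integral>\<^sup>+y. ?h x * ennreal (gauss t (x - y)) + ?h y * ennreal (gauss t (x - y)) \<partial>lborel \<partial>lborel)"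
    by (intro nn_integral_mono le)
  also have "\<dots> = (\<integral>\<^sup>+x. \<integral>\<^sup>+y. ?h x * ennreal (gauss t (x - y)) \<partial>lborel \<partial>lborel)
      + (\<integral>\<^sup>+x. \<integral>\<^sup>+y. ?h y * ennreal (gauss t (x - y)) \<partial>lborel \<partial>lborel)"
    by (simp add: nn_integral_add)
  also have "(\<integral>\<^sup>+x. \<integral>\<^sup>+y. ?h y * ennreal (gauss t (x - y)) \<partial>lborel \<partial>lborel)
      = (\<integral>\<^sup>+y. \<integral>\<^sup>+x. ?h y * ennreal (gauss t (x - y)) \<partial>lborel \<partial>lborel)"
    by (rule lborel_pair.Fubini') measurable
  also have "(\<integral>\<^sup>+x. \<integral>\<^sup>+y. ?h x * ennreal (gauss t (x - y)) \<partial>lborel \<partial>lborel)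
      + (\<integral>\<^sup>+y. \<integral>\<^sup>+x. ?h y * ennreal (gauss t (x - y)) \<partial>lborel \<partial>lborel) = (\<integral>\<^sup>+x. ?h x * ?c + ?h x * ?c \<partial>lborel)"
    by (simp add: nn_integral_add nn_integral_cmult g g')
  also have "\<dots> = (\<integral>\<^sup>+x. ?c * ennreal ((norm (u x))\<^sup>2) \<partial>lborel)"
  proof (rule nn_integral_cong)
    fix x
    have "ennreal ((norm (u x))\<^sup>2) = ?h x + ?h x"
      by (simp flip: ennreal_plus)
    then show "?h x * ?c + ?h x * ?c = ?c * ennreal ((norm (u x))\<^sup>2)"
      by (simp only: distrib_left mult.commute)
  qed
  also have "\<dots> = ?c * (\<integral>\<^sup>+x. ennreal ((norm (u x))\<^sup>2) \<partial>lborel)"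
    by (rule nn_integral_cmult) simp
  finally show ?thesis .
qed

text \<open>
  By \<open>integral_ft_mult\<close> and \<open>ft_gauss_ft\<close>, the Gaussian-weighted integral of \<open>|ft s u|\<^sup>2\<close> is a
  double integral of \<open>u\<close> against a Gaussian kernel, which Schur's test bounds independently of \<open>t\<close>;
  Fatou's lemma then removes the weight as \<open>t \<rightarrow> 0\<close>.
\<close>

lemma
  fixes u :: "'a::euclidean_space \<Rightarrow> complex"
  assumes s: "s\<^sup>2 = 1" and u: "integrable lborel u" and u2: "integrable lborel (\<lambda>x. (norm (u x))\<^sup>2)"
  shows integrable_norm_ft_square: "integrable lborel (\<lambda>\<xi>. (norm (ft s u \<xi>))\<^sup>2)"
    and integral_norm_ft_square_le:
      "(\<integral>\<xi>. (norm (ft s u \<xi>))\<^sup>2 \<partial>lborel) \<le> (2 * pi) ^ DIM('a) * (\<integral>x. (norm (u x))\<^sup>2 \<partial>lborel)"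
proof -
  have [measurable]: "u \<in> borel_measurable borel" using u by (auto dest: borel_measurable_integrable)
  define U where "U = (\<integral>x. (norm (u x))\<^sup>2 \<partial>lborel)"
  have U0: "U \<ge> 0" unfolding U_def by simp
  have U: "(\<integral>\<^sup>+x. ennreal ((norm (u x))\<^sup>2) \<partial>lborel) = ennreal U"
    unfolding U_def by (rule nn_integral_eq_integral[OF u2]) simp
  have bound: "(\<integral>\<^sup>+\<xi>. ennreal (gauss t \<xi> * (norm (ft s u \<xi>))\<^sup>2) \<partial>lborel) \<le> ennreal ((2 * pi) ^ DIM('a) * U)"
    if t: "t > 0" for t
  proof -
    let ?g = "\<lambda>\<xi>. complex_of_real (gauss t \<xi>) * cnj (ft s u \<xi>)"
    let ?c = "sqrt (2 * pi / t) ^ DIM('a)"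
    define N where "N = (\<integral>x. norm (u x) \<partial>lborel)"
    have N: "norm (ft s u \<xi>) \<le> N" for \<xi> unfolding N_def by (rule norm_ft_le)
    then have N0: "N \<ge> 0" using norm_ge_zero order_trans by blast
    have N2: "(norm (ft s u \<xi>))\<^sup>2 \<le> N\<^sup>2" for \<xi> by (rule power_mono[OF N]) simp
    \<comment> \<open>\<open>ft s u\<close> is bounded by \<open>N\<close> but need not be
      integrable; the Gaussian factor is what makes \<open>integral_ft_mult\<close> applicable to
      \<open>?g\<close>.\<close>
    have ig: "integrable lborel ?g"
      by (rule Bochner_Integration.integrable_bound[OF integrable_mult_right[OF integrable_gauss[OF t], of N]])
         (auto simp: norm_mult mult.commute[of N] intro!: mult_left_mono order_trans[OF N abs_ge_self] simp: abs_mult)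
    \<comment> \<open>Conjugation flips the sign of the exponent, giving the opposite transform that
      \<open>ft_gauss_ft\<close> evaluates.\<close>
    have cnj_ft: "ft s ?g x = cnj (ft (- s) (\<lambda>\<xi>. gauss t \<xi> * ft s u \<xi>) x)" for x
      unfolding ft_def[of s "?g"] ft_def[of "- s"] by (simp add: cis_cnj flip: Bochner_Integration.integral_cnj)
    have ile: "integrable lborel (\<lambda>\<xi>. gauss t \<xi> * (norm (ft s u \<xi>))\<^sup>2)"
      by (rule Bochner_Integration.integrable_bound[OF integrable_mult_right[OF integrable_gauss[OF t], of "N\<^sup>2"]])
         (auto simp: mult.commute[of "N\<^sup>2"] intro!: mult_left_mono N2)
    have "complex_of_real (gauss t \<xi> * (norm (ft s u \<xi>))\<^sup>2) = ft s u \<xi> * ?g \<xi>" for \<xi>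
      by (simp only: of_real_mult complex_norm_square mult_ac)
    then have "complex_of_real (\<integral>\<xi>. gauss t \<xi> * (norm (ft s u \<xi>))\<^sup>2 \<partial>lborel)
        = (\<integral>\<xi>. ft s u \<xi> * ?g \<xi> \<partial>lborel)"
      by (simp only: flip: integral_complex_of_real)
    also have "\<dots> = (\<integral>x. u x * ft s ?g x \<partial>lborel)"
      by (rule integral_ft_mult[OF u ig])
    finally have eq: "complex_of_real (\<integral>\<xi>. gauss t \<xi> * (norm (ft s u \<xi>))\<^sup>2 \<partial>lborel)
        = (\<integral>x. u x * ft s ?g x \<partial>lborel)" .
    have nn: "0 \<le> (\<integral>\<xi>. gauss t \<xi> * (norm (ft s u \<xi>))\<^sup>2 \<partial>lborel)"
      by (intro integral_nonneg_AE) simp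
    have ftle: "ennreal (norm (ft s ?g x)) \<le> ?c * (\<integral>\<^sup>+y. ennreal (norm (u y) * gauss (1 / t) (x - y)) \<partial>lborel)" for x
    proof -
      have "norm (ft s ?g x) = ?c * norm (\<integral>y. u y * gauss (1 / t) (x - y) \<partial>lborel)"
        unfolding cnj_ft complex_mod_cnj ft_gauss_ft[OF t s u] norm_mult norm_of_real using t by simp
      also have "ennreal \<dots> = ennreal ?c * ennreal (norm (\<integral>y. u y * gauss (1 / t) (x - y) \<partial>lborel))"
        using t by (intro ennreal_mult) auto
      also have "ennreal (norm (\<integral>y. u y * gauss (1 / t) (x - y) \<partial>lborel))
          \<le> (\<integral>\<^sup>+y. ennreal (norm (u y * gauss (1 / t) (x - y))) \<partial>lborel)"
      proof (rule integral_norm_bound_ennreal)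
        show "integrable lborel (\<lambda>y. u y * complex_of_real (gauss (1 / t) (x - y)))"
          by (rule Bochner_Integration.integrable_bound[OF u])
             (auto simp: norm_mult gauss_le_1 less_imp_le[OF t] intro!: mult_left_le)
      qed
      finally show ?thesis by (simp add: norm_mult mult_left_mono)
    qed
    have "(\<integral>\<^sup>+\<xi>. ennreal (gauss t \<xi> * (norm (ft s u \<xi>))\<^sup>2) \<partial>lborel)
        = ennreal (norm (complex_of_real (\<integral>\<xi>. gauss t \<xi> * (norm (ft s u \<xi>))\<^sup>2 \<partial>lborel)))"
      by (subst nn_integral_eq_integral[OF ile]) (use nn in auto)
    also have "\<dots> \<le> (\<integral>\<^sup>+x. ennreal (norm (u x * ft s ?g x)) \<partial>lborel)"
      unfolding eq
    proof (rule integral_norm_bound_ennreal)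
      have [measurable]: "ft s ?g \<in> borel_measurable borel"
        using borel_measurable_integrable[OF ig] by (intro borel_measurable_ft) simp
      define L where "L = (\<integral>x. norm (?g x) \<partial>lborel)"
      have "norm (ft s ?g x) \<le> \<bar>L\<bar>" for x
        unfolding L_def by (rule order_trans[OF norm_ft_le abs_ge_self])
      then have "norm (u x * ft s ?g x) \<le> norm (of_real L * u x)" for x
        unfolding norm_mult norm_of_real by (subst mult.commute) (intro mult_right_mono norm_ge_zero)
      then show "integrable lborel (\<lambda>x. u x * ft s ?g x)"
        by (intro Bochner_Integration.integrable_bound[OF integrable_mult_right[OF u, of "of_real L"]]) auto
    qed
    also have "\<dots> \<le> (\<integral>\<^sup>+x. \<integral>\<^sup>+y. ennreal ?c * ennreal (norm (u x) * norm (u y) * gauss (1 / t) (x - y)) \<partial>lborel \<partial>lborel)"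
    proof (rule nn_integral_mono)
      fix x
      have "ennreal (norm (u x * ft s ?g x)) = ennreal (norm (u x)) * ennreal (norm (ft s ?g x))"
        by (simp add: norm_mult ennreal_mult)
      also have "\<dots> \<le> ennreal (norm (u x)) * (?c * (\<integral>\<^sup>+y. ennreal (norm (u y) * gauss (1 / t) (x - y)) \<partial>lborel))"
        by (intro mult_left_mono ftle) simp
      also have "\<dots> = (\<integral>\<^sup>+y. ennreal (norm (u x)) * (?c * ennreal (norm (u y) * gauss (1 / t) (x - y))) \<partial>lborel)"
        by (simp add: nn_integral_cmult)
      also have "\<dots> = (\<integral>\<^sup>+y. ennreal ?c * ennreal (norm (u x) * norm (u y) * gauss (1 / t) (x - y)) \<partial>lborel)"
        by (simp add: ennreal_mult mult_ac)
      finally show "ennreal (norm (u x * ft s ?g x)) \<le> \<dots>" .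
    qed
    also have "\<dots> = ?c * (\<integral>\<^sup>+x. \<integral>\<^sup>+y. ennreal (norm (u x) * norm (u y) * gauss (1 / t) (x - y)) \<partial>lborel \<partial>lborel)"
      by (simp add: nn_integral_cmult)
    also have "\<dots> \<le> ?c * (ennreal (sqrt (2 * pi / (1 / t)) ^ DIM('a)) * ennreal U)"
      unfolding U[symmetric] using t by (intro mult_left_mono nn_integral_schur_gauss) auto
    also have "\<dots> = ennreal (?c * sqrt (2 * pi / (1 / t)) ^ DIM('a) * U)"
      using t U0 by (simp add: ennreal_mult mult.assoc)
    \<comment> \<open>The height of the kernel carries \<open>2 * pi / t\<close> and its mass
      \<open>2 * pi * t\<close> under the roots, so \<open>t\<close> cancels.\<close>
    also have "?c * sqrt (2 * pi / (1 / t)) ^ DIM('a) = (2 * pi) ^ DIM('a)"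
    proof -
      have "2 * pi / t * (2 * pi / (1 / t)) = (2 * pi)\<^sup>2"
        using t by (simp add: power2_eq_square)
      then have "sqrt (2 * pi / t) * sqrt (2 * pi / (1 / t)) = 2 * pi"
        by (simp only: real_sqrt_mult[symmetric]) (simp only: real_sqrt_abs, simp)
      then show ?thesis
        by (simp only: power_mult_distrib[symmetric])
    qed
    finally show ?thesis .
  qed
  have lim: "(\<lambda>k. gauss (1 / real (Suc k)) \<xi> * (norm (ft s u \<xi>))\<^sup>2) \<longlonglongrightarrow> (norm (ft s u \<xi>))\<^sup>2" for \<xi>
  proof -
    have "(\<lambda>k. exp (- (1 / real (Suc k) * (norm \<xi>)\<^sup>2 / 2)) * (norm (ft s u \<xi>))\<^sup>2)
      \<longlonglongrightarrow> exp (- (0 * (norm \<xi>)\<^sup>2 / 2)) * (norm (ft s u \<xi>))\<^sup>2"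
      by (intro tendsto_intros LIMSEQ_Suc[OF lim_1_over_n]) auto
    then show ?thesis by (simp add: gauss_def)
  qed
  have "(\<integral>\<^sup>+\<xi>. ennreal ((norm (ft s u \<xi>))\<^sup>2) \<partial>lborel)
      = (\<integral>\<^sup>+\<xi>. liminf (\<lambda>k. ennreal (gauss (1 / real (Suc k)) \<xi> * (norm (ft s u \<xi>))\<^sup>2)) \<partial>lborel)"
    by (intro nn_integral_cong sym[OF lim_imp_Liminf] tendsto_ennrealI lim) simp
  also have "\<dots> \<le> liminf (\<lambda>k. \<integral>\<^sup>+\<xi>. ennreal (gauss (1 / real (Suc k)) \<xi> * (norm (ft s u \<xi>))\<^sup>2) \<partial>lborel)"
    by (rule nn_integral_liminf) measurable
  also have "\<dots> \<le> liminf (\<lambda>k::nat. ennreal ((2 * pi) ^ DIM('a) * U))"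
    by (intro Liminf_mono always_eventually allI bound) simp
  also have "\<dots> = ennreal ((2 * pi) ^ DIM('a) * U)"
    by (simp add: Liminf_const)
  finally have le: "(\<integral>\<^sup>+\<xi>. ennreal ((norm (ft s u \<xi>))\<^sup>2) \<partial>lborel) \<le> ennreal ((2 * pi) ^ DIM('a) * U)" .
  show int: "integrable lborel (\<lambda>\<xi>. (norm (ft s u \<xi>))\<^sup>2)"
    using le by (intro integrableI_bounded) (auto simp: less_top[symmetric] top_unique)
  show "(\<integral>\<xi>. (norm (ft s u \<xi>))\<^sup>2 \<partial>lborel) \<le> (2 * pi) ^ DIM('a) * (\<integral>x. (norm (u x))\<^sup>2 \<partial>lborel)"
    using le nn_integral_eq_integral[OF int] U0 unfolding U_def[symmetric] by simp
qed

section \<open>Fourier transforms on square-integrable functions\<close>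

abbreviation gaussian :: "'a::euclidean_space \<Rightarrow> complex" where
  "gaussian x \<equiv> complex_of_real (gauss 1 x)"

lemma fourier_eq_ft:
  assumes [measurable]: "u \<in> borel_measurable borel"
  shows "fourier u = ft (- 1) u"
proof
  fix \<xi>
  show "fourier u \<xi> = ft (- 1) u \<xi>"
    unfolding fourier_def ft_def by (subst integral_completion) auto
qed

lemma inv_fourier_eq_ft:
  fixes g :: "real^'n \<Rightarrow> complex"
  assumes [measurable]: "g \<in> borel_measurable borel"
  shows "inv_fourier g x = complex_of_real ((2 * pi) powr (- real CARD('n))) * ft 1 g x"
  unfolding inv_fourier_def ft_def by (subst integral_completion) (auto simp: inner_commute)

text \<open>The squared distance of \<open>g\<close> and \<open>g'\<close> is at most twice the sum
  of their squared distances to \<open>h R\<close>, which tends to 0. Equality almost everywhere is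
  all that can be known about a limit picked by \<open>SOME\<close>.\<close>

lemma L2_limit_unique:
  assumes g: "L2_limit_of h g" and g': "L2_limit_of h g'"
  shows "AE x in lebesgue. g x = g' x"
proof -
  have [measurable]: "g \<in> borel_measurable lebesgue" "g' \<in> borel_measurable lebesgue"
    using assms by (auto simp: L2_limit_of_def L2_def)
  have le: "(norm (a - b))\<^sup>2 \<le> 2 * (norm (c - a))\<^sup>2 + 2 * (norm (c - b))\<^sup>2" for a b c :: complex
  proof -
    have "norm (a - b) \<le> norm (c - a) + norm (c - b)"
      using norm_triangle_ineq4[of "c - b" "c - a"] by simp
    then have "(norm (a - b))\<^sup>2 \<le> (norm (c - a) + norm (c - b))\<^sup>2"
      by (rule power_mono) simp
    then show ?thesis
      using sum_squares_bound[of "norm (c - a)" "norm (c - b)"] by (simp add: power2_sum)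
  qed
  let ?I = "\<integral>x. (norm (g x - g' x))\<^sup>2 \<partial>lebesgue"
  have ev: "\<forall>\<^sub>F R in at_top. integrable lebesgue (\<lambda>x. (norm (h R x - g x))\<^sup>2) \<and>
      integrable lebesgue (\<lambda>x. (norm (h R x - g' x))\<^sup>2)"
    using assms by (auto simp: L2_limit_of_def eventually_conj)
  have int: "integrable lebesgue (\<lambda>x. (norm (g x - g' x))\<^sup>2) \<and>
      ?I \<le> 2 * (\<integral>x. (norm (h R x - g x))\<^sup>2 \<partial>lebesgue) + 2 * (\<integral>x. (norm (h R x - g' x))\<^sup>2 \<partial>lebesgue)"
    if R: "integrable lebesgue (\<lambda>x. (norm (h R x - g x))\<^sup>2) \<and> integrable lebesgue (\<lambda>x. (norm (h R x - g' x))\<^sup>2)" for R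
  proof -
    let ?B = "\<lambda>x. 2 * (norm (h R x - g x))\<^sup>2 + 2 * (norm (h R x - g' x))\<^sup>2"
    have B: "integrable lebesgue ?B" using R by auto
    have i: "integrable lebesgue (\<lambda>x. (norm (g x - g' x))\<^sup>2)"
      by (rule Bochner_Integration.integrable_bound[OF B]) (use le in auto)
    then have "?I \<le> (\<integral>x. ?B x \<partial>lebesgue)"
      by (intro integral_mono B le)
    with R i show ?thesis by simp
  qed
  have "((\<lambda>R. 2 * (\<integral>x. (norm (h R x - g x))\<^sup>2 \<partial>lebesgue) + 2 * (\<integral>x. (norm (h R x - g' x))\<^sup>2 \<partial>lebesgue))
      \<longlongrightarrow> 2 * 0 + 2 * 0) at_top"
    using assms by (intro tendsto_intros) (auto simp: L2_limit_of_def)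
  moreover have "\<forall>\<^sub>F R in at_top. ?I \<le>
      2 * (\<integral>x. (norm (h R x - g x))\<^sup>2 \<partial>lebesgue) + 2 * (\<integral>x. (norm (h R x - g' x))\<^sup>2 \<partial>lebesgue)"
    using ev by eventually_elim (use int in blast)
  ultimately have "?I \<le> 2 * 0 + 2 * 0"
    by (rule tendsto_lowerbound) simp
  moreover have "integrable lebesgue (\<lambda>x. (norm (g x - g' x))\<^sup>2)"
    using eventually_happens[OF ev] int by auto
  moreover have "?I \<ge> 0" by simp
  ultimately have "AE x in lebesgue. (norm (g x - g' x))\<^sup>2 = 0"
    by (subst integral_nonneg_eq_0_iff_AE[symmetric]) auto
  then show ?thesis by auto
qed

lemma ft_in_L2:
  fixes u :: "real^'n \<Rightarrow> complex"
  assumes "integrable lborel u" "integrable lborel (\<lambda>x. (norm (u x))\<^sup>2)" "s\<^sup>2 = 1"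
  shows "ft s u \<in> L2"
proof -
  have [measurable]: "u \<in> borel_measurable borel" using assms(1) by (auto dest: borel_measurable_integrable)
  have "ft s u \<in> borel_measurable lborel" by simp
  then show ?thesis
    using integrable_norm_ft_square[OF assms(3,1,2)]
    unfolding L2_def by (auto intro!: measurable_completion simp: integrable_completion)
qed

text \<open>For \<open>R \<ge> R0\<close> truncation does nothing, so the family is eventually
  constant and its value, the classical transform, is a limit once it is known to lie in L2.\<close>

lemma fourier_L2_eq_fourier:
  fixes u :: "real^'n \<Rightarrow> complex"
  assumes u: "integrable lborel u" "integrable lborel (\<lambda>x. (norm (u x))\<^sup>2)"
    and supp: "\<And>x. R0 \<le> norm x \<Longrightarrow> u x = 0"
  shows "fourier_L2 u \<in> L2" "AE \<xi> in lebesgue. fourier_L2 u \<xi> = fourier u \<xi>"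
proof -
  have [measurable]: "u \<in> borel_measurable borel" using u by (auto dest: borel_measurable_integrable)
  have L: "fourier u \<in> L2" using ft_in_L2[OF u] by (simp add: fourier_eq_ft)
  have tr: "truncate R u = u" if "R \<ge> R0" for R
  proof
    fix x show "truncate R u x = u x"
      using that supp[of x] by (cases "norm x < R") (auto simp: truncate_def)
  qed
  have "L2_limit_of (\<lambda>R. fourier (truncate R u)) (fourier u)"
    unfolding L2_limit_of_def
    by (intro conjI L tendsto_eventually eventually_mono[OF eventually_ge_at_top[of R0]]) (auto simp: tr)
  moreover from this have "L2_limit_of (\<lambda>R. fourier (truncate R u)) (fourier_L2 u)"
    unfolding fourier_L2_def by (rule someI[where P="L2_limit_of (\<lambda>R. fourier (truncate R u))"])
  ultimately show "fourier_L2 u \<in> L2" "AE \<xi> in lebesgue. fourier_L2 u \<xi> = fourier u \<xi>"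
    using L2_limit_unique by (simp add: L2_limit_of_def, blast)
qed

text \<open>Without compact support the truncation error \<open>d R\<close> persists. It vanishes at
  \<open>x\<close> once \<open>R > norm x\<close> and is dominated by \<open>v\<close>, hence tends
  to 0 in L2; \<open>integral_norm_ft_square_le\<close> carries this over to the inverse
  transforms.\<close>

lemma inv_fourier_L2_eq_inv_fourier:
  fixes v :: "real^'n \<Rightarrow> complex"
  assumes v: "integrable lborel v" "integrable lborel (\<lambda>x. (norm (v x))\<^sup>2)"
  shows "inv_fourier_L2 v \<in> L2" "AE x in lebesgue. inv_fourier_L2 v x = inv_fourier v x"
proof -
  have vm[measurable]: "v \<in> borel_measurable borel" using v by (auto dest: borel_measurable_integrable)
  \<comment> \<open>The normalising constant is kept opaque: only its independence of the function
    and the point matters.\<close>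
  obtain K where K: "inv_fourier w = (\<lambda>x. K * ft 1 w x)"
    if "w \<in> borel_measurable borel" for w :: "real^'n \<Rightarrow> complex"
    using inv_fourier_eq_ft by blast
  have s: "(1::real)\<^sup>2 = 1" by simp
  have L: "inv_fourier v \<in> L2"
    using ft_in_L2[OF v s] unfolding K[OF vm] L2_def mem_Collect_eq norm_mult power_mult_distrib
    by (intro conjI borel_measurable_times integrable_mult_right) auto
  have [measurable]: "ball (0::real^'n) R \<in> sets borel" for R
    by (rule borel_open) simp
  have tm[measurable]: "truncate R v \<in> borel_measurable borel" for R
    unfolding truncate_def[abs_def] by measurable
  define d where "d R x = truncate R v x - v x" for R x
  have dm[measurable]: "d R \<in> borel_measurable borel" for R
    unfolding d_def[abs_def] by measurable
  have dle: "norm (d R x) \<le> norm (v x)" for R x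
    by (auto simp: d_def truncate_def indicator_def)
  have ti: "integrable lborel (truncate R v)" for R
    by (rule Bochner_Integration.integrable_bound[OF v(1)]) (auto simp: truncate_def indicator_def)
  have di: "integrable lborel (d R)" for R
    unfolding d_def using ti v(1) by auto
  have di2: "integrable lborel (\<lambda>x. (norm (d R x))\<^sup>2)" for R
    by (rule Bochner_Integration.integrable_bound[OF v(2)]) (use dle in \<open>auto intro: power_mono\<close>)
  have diff: "inv_fourier (truncate R v) x - inv_fourier v x = K * ft 1 (d R) x" for R x
    using Bochner_Integration.integral_diff[OF integrable_mult_cis[OF ti[of R], of 1 x] integrable_mult_cis[OF v(1), of 1 x]]
    unfolding K[OF vm] K[OF tm] ft_def d_def left_diff_distrib by (simp flip: right_diff_distrib)
  have int: "integrable lborel (\<lambda>x. (norm (inv_fourier (truncate R v) x - inv_fourier v x))\<^sup>2)" for R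
    unfolding diff norm_mult power_mult_distrib
    by (intro integrable_mult_right integrable_norm_ft_square[OF s di di2])
  have int_eq: "(\<integral>x. (norm (inv_fourier (truncate R v) x - inv_fourier v x))\<^sup>2 \<partial>lebesgue)
      = (norm K)\<^sup>2 * (\<integral>x. (norm (ft 1 (d R) x))\<^sup>2 \<partial>lborel)" for R
    using borel_measurable_integrable[OF int[of R]]
    by (subst integral_completion) (auto simp: diff norm_mult power_mult_distrib)
  have "((\<lambda>R. \<integral>x. (norm (d R x))\<^sup>2 \<partial>lborel) \<longlongrightarrow> (\<integral>x. 0 \<partial>(lborel :: (real^'n) measure))) at_top"
  proof (rule integral_dominated_convergence_at_top)
    show "AE x in lborel. ((\<lambda>R. (norm (d R x))\<^sup>2) \<longlongrightarrow> 0) at_top"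
    proof (intro AE_I2 tendsto_eventually)
      fix x :: "real^'n"
      show "\<forall>\<^sub>F R in at_top. (norm (d R x))\<^sup>2 = 0"
        by (rule eventually_mono[OF eventually_gt_at_top[of "norm x"]]) (auto simp: d_def truncate_def)
    qed
    show "\<forall>\<^sub>F R in at_top. AE x in lborel. norm ((norm (d R x))\<^sup>2) \<le> (norm (v x))\<^sup>2"
      using dle by (auto intro!: always_eventually power_mono)
  qed (use v in auto)
  then have z: "((\<lambda>R. (norm K)\<^sup>2 * ((2 * pi) ^ DIM(real^'n) * (\<integral>x. (norm (d R x))\<^sup>2 \<partial>lborel))) \<longlongrightarrow> 
      (norm K)\<^sup>2 * ((2 * pi) ^ DIM(real^'n) * 0)) at_top"
    by (intro tendsto_intros) simp
  have "((\<lambda>R. (norm K)\<^sup>2 * (\<integral>x. (norm (ft 1 (d R) x))\<^sup>2 \<partial>lborel)) \<longlongrightarrow> 0) at_top"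
    by (rule tendsto_sandwich[OF _ _ tendsto_const z[simplified]])
       (auto intro!: always_eventually mult_left_mono order_trans[OF integral_norm_ft_square_le[OF s di di2]])
  then have "L2_limit_of (\<lambda>R. inv_fourier (truncate R v)) (inv_fourier v)"
    unfolding L2_limit_of_def int_eq using L int by (auto simp: integrable_completion borel_measurable_integrable)
  moreover from this have "L2_limit_of (\<lambda>R. inv_fourier (truncate R v)) (inv_fourier_L2 v)"
    unfolding inv_fourier_L2_def by (rule someI[where P="L2_limit_of (\<lambda>R. inv_fourier (truncate R v))"])
  ultimately show "inv_fourier_L2 v \<in> L2" "AE x in lebesgue. inv_fourier_L2 v x = inv_fourier v x"
    using L2_limit_unique by (simp add: L2_limit_of_def, blast)
qed

text \<open>Every truncated integral ignores null sets, so both sides choose from the same predicate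
  and agree exactly, not just almost everywhere. This absorbs the ambiguity of
  \<open>fourier_L2\<close>.\<close>

lemma inv_fourier_L2_cong:
  assumes [measurable]: "g \<in> borel_measurable lebesgue" "v \<in> borel_measurable lebesgue"
    and ae: "AE \<xi> in lebesgue. g \<xi> = v \<xi>"
  shows "inv_fourier_L2 g = inv_fourier_L2 v"
proof -
  have "inv_fourier (truncate R g) x = inv_fourier (truncate R v) x" for R x
  proof -
    have [measurable]: "ball 0 R \<in> sets lebesgue" by simp
    have [measurable]: "(\<lambda>\<xi>. cis (x \<bullet> \<xi>)) \<in> borel_measurable lebesgue"
      by (intro measurable_completion) simp
    show ?thesis
      unfolding inv_fourier_def truncate_def
      by (intro arg_cong2[where f="(*)"] refl integral_cong_AE) (use ae in auto)
  qed
  then show ?thesis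
    unfolding inv_fourier_L2_def by presburger
qed

section \<open>The Gaussian multiplier as an averaging operator\<close>

lemma integrable_gaussian_ft:
  assumes "integrable lborel u"
  shows "integrable lborel (\<lambda>\<xi>. gaussian \<xi> * ft s u \<xi>)"
    and "integrable lborel (\<lambda>\<xi>. (norm (gaussian \<xi> * ft s u \<xi>))\<^sup>2)"
proof -
  have [measurable]: "u \<in> borel_measurable borel" using assms by (auto dest: borel_measurable_integrable)
  define N where "N = (\<integral>x. norm (u x) \<partial>lborel)"
  have N: "norm (ft s u \<xi>) \<le> N" for \<xi> unfolding N_def by (rule norm_ft_le)
  then have N0: "N \<ge> 0" using norm_ge_zero order_trans by blast
  have le: "norm (gaussian \<xi> * ft s u \<xi>) \<le> N * gauss 1 \<xi>" for \<xi>
    using mult_right_mono[OF N, of "gauss 1 \<xi>"] by (simp add: norm_mult mult.commute)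
  have g: "integrable lborel (gauss 1)" by (rule integrable_gauss) simp
  show "integrable lborel (\<lambda>\<xi>. gaussian \<xi> * ft s u \<xi>)"
    by (rule Bochner_Integration.integrable_bound[OF integrable_mult_right[OF g, of N]])
       (auto simp del: of_real_mult intro!: order_trans[OF le abs_ge_self])
  have "(norm (gaussian \<xi> * ft s u \<xi>))\<^sup>2 \<le> N\<^sup>2 * gauss 1 \<xi>" for \<xi>
  proof -
    have "(norm (gaussian \<xi> * ft s u \<xi>))\<^sup>2 \<le> (N * gauss 1 \<xi>)\<^sup>2"
      by (intro power_mono le) simp
    also have "\<dots> = N\<^sup>2 * (gauss 1 \<xi> * gauss 1 \<xi>)"
      by (simp add: power2_eq_square)
    also have "\<dots> \<le> N\<^sup>2 * (1 * gauss 1 \<xi>)"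
      by (intro mult_left_mono mult_right_mono gauss_le_1) auto
    finally show ?thesis by simp
  qed
  then show "integrable lborel (\<lambda>\<xi>. (norm (gaussian \<xi> * ft s u \<xi>))\<^sup>2)"
    by (intro Bochner_Integration.integrable_bound[OF integrable_mult_right[OF g, of "N\<^sup>2"]]) auto
qed

text \<open>Convolution with the standard normal density. The constant is what remains of the factor
  of \<open>inv_fourier\<close>, of exponent -n, times the \<open>sqrt (2 * pi) ^ n\<close> of the
  transformed Gaussian, for n the dimension.\<close>

definition gauss_conv :: "(real^'n \<Rightarrow> complex) \<Rightarrow> real^'n \<Rightarrow> complex" where
  "gauss_conv u x = complex_of_real ((2 * pi) powr (- (real CARD('n) / 2))) * (\<integral>y. u y * gauss 1 (x - y) \<partial>lborel)"

lemma inv_fourier_gaussian_fourier: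
  fixes u :: "real^'n \<Rightarrow> complex"
  assumes u: "integrable lborel u"
  shows "inv_fourier (\<lambda>\<xi>. gaussian \<xi> * fourier u \<xi>) = gauss_conv u"
proof
  fix x :: "real^'n"
  have [measurable]: "u \<in> borel_measurable borel" using u by (auto dest: borel_measurable_integrable)
  have "(2 * pi) powr (- real CARD('n)) * sqrt (2 * pi) ^ CARD('n) = (2 * pi) powr (- (real CARD('n) / 2))"
    by (simp add: powr_half_sqrt[symmetric] powr_powr powr_add[symmetric] flip: powr_realpow)
  then have "complex_of_real ((2 * pi) powr (- real CARD('n))) * (of_real (sqrt (2 * pi) ^ CARD('n)) * z)
     = of_real ((2 * pi) powr (- (real CARD('n) / 2))) * z" for z
    by (metis of_real_mult mult.assoc)
  with ft_gauss_ft[of 1 "-1" u x] u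
  show "inv_fourier (\<lambda>\<xi>. gaussian \<xi> * fourier u \<xi>) x = gauss_conv u x"
    by (subst inv_fourier_eq_ft) (simp_all add: fourier_eq_ft gauss_conv_def)
qed

text \<open>Both choices by \<open>SOME\<close> are resolved here: the forward one by
  \<open>inv_fourier_L2_cong\<close>, the inverse one by integrability and square-integrability of
  the Gaussian times a bounded transform.\<close>

lemma inv_fourier_L2_gaussian_fourier_L2:
  fixes u :: "real^'n \<Rightarrow> complex"
  assumes u: "integrable lborel u" "integrable lborel (\<lambda>x. (norm (u x))\<^sup>2)"
    and supp: "\<And>x. R0 \<le> norm x \<Longrightarrow> u x = 0"
  shows "inv_fourier_L2 (\<lambda>\<xi>. gaussian \<xi> * fourier_L2 u \<xi>) \<in> borel_measurable lebesgue"
    and "AE x in lebesgue. inv_fourier_L2 (\<lambda>\<xi>. gaussian \<xi> * fourier_L2 u \<xi>) x = gauss_conv u x"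
proof -
  let ?v = "\<lambda>\<xi>. gaussian \<xi> * ft (- 1) u \<xi>"
  have [measurable]: "u \<in> borel_measurable borel" using u by (auto dest: borel_measurable_integrable)
  have gm[measurable]: "(gaussian :: real^'n \<Rightarrow> complex) \<in> borel_measurable lebesgue"
    by (intro measurable_completion) simp
  have [measurable]: "fourier_L2 u \<in> borel_measurable lebesgue"
    using fourier_L2_eq_fourier(1)[OF u supp] by (simp add: L2_def)
  have fm[measurable]: "ft (- 1) u \<in> borel_measurable lebesgue"
    by (intro measurable_completion) simp
  have "AE \<xi> in lebesgue. fourier_L2 u \<xi> = fourier u \<xi>"
    using fourier_L2_eq_fourier(2)[OF u] supp by blast
  then have "AE \<xi> in lebesgue. gaussian \<xi> * fourier_L2 u \<xi> = ?v \<xi>"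
    by eventually_elim (simp add: fourier_eq_ft)
  then have eq: "inv_fourier_L2 (\<lambda>\<xi>. gaussian \<xi> * fourier_L2 u \<xi>) = inv_fourier_L2 ?v"
    by (intro inv_fourier_L2_cong borel_measurable_times) measurable
  note i = inv_fourier_L2_eq_inv_fourier[OF integrable_gaussian_ft[OF u(1), of "- 1"]]
  show "inv_fourier_L2 (\<lambda>\<xi>. gaussian \<xi> * fourier_L2 u \<xi>) \<in> borel_measurable lebesgue"
    using i(1) unfolding eq by (simp add: L2_def)
  show "AE x in lebesgue. inv_fourier_L2 (\<lambda>\<xi>. gaussian \<xi> * fourier_L2 u \<xi>) x = gauss_conv u x"
    using i(2) unfolding eq inv_fourier_gaussian_fourier[OF u(1), symmetric] by (simp add: fourier_eq_ft)
qed

lemma powr_mult_integral_gauss_shift: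
  "(2 * pi) powr (- (real CARD('n) / 2)) * (\<integral>y. gauss 1 (x - y :: real^'n) \<partial>lborel) = 1"
  by (simp add: integral_gauss_shift powr_half_sqrt[symmetric] powr_powr powr_add[symmetric] flip: powr_realpow)

text \<open>The kernel is nonnegative and has mass 1, so this is a bound on an average.\<close>

lemma norm_gauss_conv_le:
  fixes u :: "real^'n \<Rightarrow> complex"
  assumes [measurable]: "u \<in> borel_measurable borel" and M: "\<And>y. norm (u y) \<le> M"
  shows "norm (gauss_conv u x) \<le> M"
proof -
  have i: "integrable lborel (\<lambda>y. M * gauss 1 (x - y))"
    by (intro integrable_mult_right integrable_gauss_shift) simp
  have le: "norm (u y * gauss 1 (x - y)) \<le> M * gauss 1 (x - y)" for y
    using M by (simp add: norm_mult mult_right_mono)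
  have "integrable lborel (\<lambda>y. u y * gauss 1 (x - y))"
    by (rule Bochner_Integration.integrable_bound[OF i]) (auto intro!: order_trans[OF le abs_ge_self])
  then have "norm (\<integral>y. u y * gauss 1 (x - y) \<partial>lborel) \<le> (\<integral>y. M * gauss 1 (x - y) \<partial>lborel)"
    by (intro Bochner_Integration.integral_norm_bound_integral i le)
  then have "norm (gauss_conv u x)
      \<le> (2 * pi) powr (- (real CARD('n) / 2)) * (\<integral>y. M * gauss 1 (x - y) \<partial>lborel)"
    unfolding gauss_conv_def norm_mult by (intro mult_mono) auto
  also have "\<dots> = M * ((2 * pi) powr (- (real CARD('n) / 2)) * (\<integral>y. gauss 1 (x - y) \<partial>lborel))"
    by simp
  finally show ?thesis unfolding powr_mult_integral_gauss_shift by simp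
qed

lemma borel_measurable_gauss_conv:
  assumes [measurable]: "u \<in> borel_measurable borel"
  shows "gauss_conv u \<in> borel_measurable borel"
  unfolding gauss_conv_def[abs_def] by measurable

text \<open>On \<open>A\<close> the Gaussian kernel stays above its value at distance
  \<open>D\<close>. The bound sees \<open>A\<close> only through \<open>D\<close> and its measure,
  which is why it is uniform over translates.\<close>

lemma gauss_conv_indicator_ge:
  fixes A :: "(real^'n) set"
  assumes A: "A \<in> sets borel" "emeasure lborel A < \<infinity>" and D: "\<And>y. y \<in> A \<Longrightarrow> norm (x - y) \<le> D"
  shows "norm (gauss_conv (\<lambda>y. of_real (indicator A y)) x)
    \<ge> (2 * pi) powr (- (real CARD('n) / 2)) * (exp (- D\<^sup>2 / 2) * measure lborel A)"
proof -
  have i: "integrable lborel (\<lambda>y. indicator A y * gauss 1 (x - y))"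
    by (rule Bochner_Integration.integrable_bound[OF integrable_gauss_shift[of 1 x]])
       (use A in \<open>auto simp: indicator_def\<close>)
  have i2: "integrable lborel (\<lambda>y. exp (- D\<^sup>2 / 2) * indicator A y)"
    using A by (intro integrable_mult_right) auto
  have "exp (- D\<^sup>2 / 2) * measure lborel A = (\<integral>y. exp (- D\<^sup>2 / 2) * indicator A y \<partial>lborel)"
    using A by simp
  also have "\<dots> \<le> (\<integral>y. indicator A y * gauss 1 (x - y) \<partial>lborel)"
  proof (rule integral_mono[OF i2 i])
    fix y
    have "gauss 1 (x - y) \<ge> exp (- D\<^sup>2 / 2)" if "y \<in> A"
      using power_mono[OF D[OF that], of 2] by (simp add: gauss_def)
    then show "exp (- D\<^sup>2 / 2) * indicator A y \<le> indicator A y * gauss 1 (x - y)"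
      by (auto simp: indicator_def)
  qed
  finally have le: "exp (- D\<^sup>2 / 2) * measure lborel A \<le> (\<integral>y. indicator A y * gauss 1 (x - y) \<partial>lborel)" .
  have "gauss_conv (\<lambda>y. of_real (indicator A y)) x
      = of_real ((2 * pi) powr (- (real CARD('n) / 2)) * (\<integral>y. indicator A y * gauss 1 (x - y) \<partial>lborel))"
    unfolding gauss_conv_def by (simp flip: of_real_mult)
  then have "norm (gauss_conv (\<lambda>y. of_real (indicator A y)) x)
      = \<bar>(2 * pi) powr (- (real CARD('n) / 2)) * (\<integral>y. indicator A y * gauss 1 (x - y) \<partial>lborel)\<bar>"
    by (simp only: norm_of_real)
  then show ?thesis
    using mult_left_mono[OF le, of "(2 * pi) powr (- (real CARD('n) / 2))"] by simp
qed

section \<open>The weight\<close>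

text \<open>A nonempty open set is not negligible, so a lower bound valid almost everywhere on it
  cannot escape the essential supremum.\<close>

lemma ereal_le_esssup_lebesgue:
  fixes f :: "'a::euclidean_space \<Rightarrow> ereal"
  assumes W: "open W" "W \<noteq> {}" and ae: "AE y in lebesgue. y \<in> W \<longrightarrow> c \<le> f y"
  shows "c \<le> esssup lebesgue f"
proof (rule ccontr)
  assume less: "\<not> c \<le> esssup lebesgue f"
  from ae esssup_AE[of f lebesgue] have "AE y in lebesgue. y \<notin> W"
    by eventually_elim (use less order_trans in blast)
  moreover have "W \<in> sets lebesgue"
    using W(1) by simp
  ultimately have "W \<in> null_sets lebesgue"
    by (simp add: AE_iff_null_sets)
  then show False
    using open_not_negligible[OF W] by (simp add: negligible_iff_null_sets)
qed

lemma shiftG_eq: "shiftG G m = (+) (axis first_idx (2 * real m)) ` G"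
  by (simp add: shiftG_def)

lemma shiftG_bounds:
  assumes "\<forall>x\<in>G. \<forall>i. 0 \<le> x $ i \<and> x $ i \<le> 1" "y \<in> shiftG G m"
  shows "2 * real m \<le> y $ first_idx" "y $ first_idx \<le> 2 * real m + 1"
  using assms by (auto simp: shiftG_def axis_def)

text \<open>The first coordinate confines the copies to the disjoint intervals from
  \<open>2 * m\<close> to \<open>2 * m + 1\<close>, so the choice in \<open>weight_pos\<close> has a
  single candidate.\<close>

lemma weight_pos_shiftG:
  assumes cube: "\<forall>x\<in>G. \<forall>i. 0 \<le> x $ i \<and> x $ i \<le> 1" and y: "m \<ge> 1" "y \<in> shiftG G m"
  shows "weight_pos G b y = b m"
proof -
  have unique: "m' = m" if "y \<in> shiftG G m'" for m'
  proof -
    have "2 * real m' \<le> 2 * real m + 1" "2 * real m \<le> 2 * real m' + 1"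
      using shiftG_bounds[OF cube that] shiftG_bounds[OF cube y(2)] by auto
    then have "2 * m' \<le> 2 * m + 1" "2 * m \<le> 2 * m' + 1" by linarith+
    then show ?thesis by presburger
  qed
  have "(SOME m. m \<ge> 1 \<and> y \<in> shiftG G m) = m"
    by (rule some_equality) (use y unique in blast)+
  moreover have "\<exists>m\<ge>1. y \<in> shiftG G m" using y by blast
  ultimately show ?thesis by (simp only: weight_pos_def if_True)
qed

lemma weight_pos_outside:
  "(\<And>m. m \<ge> 1 \<Longrightarrow> y \<notin> shiftG G m) \<Longrightarrow> weight_pos G b y = 1"
  unfolding weight_pos_def by (rule if_not_P) blast

lemma closed_shiftG: "compact G \<Longrightarrow> closed (shiftG G m)"
  unfolding shiftG_eq by (intro compact_imp_closed compact_translation)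

text \<open>The obstacle is the chosen index. On a copy the first coordinate determines it as the
  floor of its half, which replaces \<open>SOME\<close> by an explicit Borel function.\<close>

lemma borel_measurable_weight:
  fixes G :: "(real^'n::{finite,wellorder}) set"
  assumes G: "compact G" and cube: "\<forall>x\<in>G. \<forall>i. 0 \<le> x $ i \<and> x $ i \<le> 1"
  shows "weight G b \<in> borel_measurable borel"
proof -
  have [measurable]: "shiftG G m \<in> sets borel" for m
    using closed_shiftG[OF G] by (rule borel_closed)
  have eq: "weight_pos G b = (\<lambda>y. if \<exists>m\<ge>1. y \<in> shiftG G m then b (nat \<lfloor>y $ first_idx / 2\<rfloor>) else 1)"
  proof
    fix y
    show "weight_pos G b y = (if \<exists>m\<ge>1. y \<in> shiftG G m then b (nat \<lfloor>y $ first_idx / 2\<rfloor>) else 1)"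
    proof (cases "\<exists>m\<ge>1. y \<in> shiftG G m")
      case True
      then obtain m where m: "m \<ge> 1" "y \<in> shiftG G m" by auto
      have "\<lfloor>y $ first_idx / 2\<rfloor> = int m"
        using shiftG_bounds[OF cube m(2)] by (simp add: floor_eq_iff)
      then show ?thesis using True weight_pos_shiftG[OF cube m] by simp
    next
      case False
      then show ?thesis using weight_pos_outside by (subst if_not_P) blast+
    qed
  qed
  have c: "(\<lambda>y::real^'n::{finite,wellorder}. y $ first_idx) \<in> borel_measurable borel"
    by (intro borel_measurable_continuous_onI continuous_intros)
  have [measurable]: "weight_pos G b \<in> borel_measurable borel"
  proof -
    have [measurable]: "(\<lambda>y. b (nat \<lfloor>y $ first_idx / 2\<rfloor>)) \<in> borel_measurable (borel :: (real^'n::{finite,wellorder}) measure)"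
      using c by measurable
    show ?thesis
      unfolding eq by measurable
  qed
  show ?thesis
    unfolding weight_def[abs_def] using c by measurable
qed

lemma weight_bounds:
  assumes b: "\<forall>m\<ge>1. 0 < b m \<and> b m < 1"
  shows "0 < weight G b y" "weight G b y \<le> 1"
proof -
  have "0 < weight_pos G b y \<and> weight_pos G b y \<le> 1" for y
  proof (cases "\<exists>m\<ge>1. y \<in> shiftG G m")
    case True
    then have "(SOME m. m \<ge> 1 \<and> y \<in> shiftG G m) \<ge> 1"
      using someI_ex[of "\<lambda>m. m \<ge> 1 \<and> y \<in> shiftG G m"] by auto
    with True b show ?thesis by (auto simp: weight_pos_def less_imp_le)
  next
    case False
    then have "weight_pos G b y = 1" by (intro weight_pos_outside) blast
    then show ?thesis by simp
  qed
  then show "0 < weight G b y" "weight G b y \<le> 1" by (auto simp: weight_def)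
qed

text \<open>A finite union of closed sets with empty interior has empty interior, so a nonempty open
  set is not covered by it. Finitely many copies suffice because the argument is localised to a slab
  in the first coordinate.\<close>

lemma weight_dense_eq_1:
  fixes G :: "(real^'n::{finite,wellorder}) set"
  assumes G: "compact G" "interior G = {}" and cube: "\<forall>x\<in>G. \<forall>i. 0 \<le> x $ i \<and> x $ i \<le> 1"
    and V: "open V" "V \<noteq> {}"
  obtains W where "open W" "W \<noteq> {}" "W \<subseteq> V" "\<And>y. y \<in> W \<Longrightarrow> weight G b y = 1"
proof -
  define B where "B N = (\<Union>m\<in>{1..N}. shiftG G m \<union> uminus ` shiftG G m)" for N :: nat
  have closed: "closed (shiftG G m)" "closed (uminus ` shiftG G m)" for m
    using closed_shiftG[OF G(1), of m] by (auto intro: closed_negations)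
  have int: "interior (shiftG G m) = {}" "interior (uminus ` shiftG G m) = {}" for m
    using G(2) by (auto simp: shiftG_eq interior_translation interior_negations)
  have cB: "closed (B N)" for N
    unfolding B_def using closed by (intro closed_UN) auto
  have iB: "interior (B N) = {}" for N
  proof (induction N)
    case (Suc N)
    have "B (Suc N) = B N \<union> (shiftG G (Suc N) \<union> uminus ` shiftG G (Suc N))"
      unfolding B_def using atLeastAtMostSuc_conv[of 1 N] by (simp add: Un_commute)
    then show ?case
      using Suc by (simp add: interior_closed_Un_empty_interior cB closed int)
  qed (simp add: B_def)
  obtain y0 where y0: "y0 \<in> V" using V by auto
  \<comment> \<open>Copies of index \<open>m > N\<close>, and their reflections, have first
    coordinate of modulus at least \<open>2 * m > N\<close> and so miss the slab.\<close>
  obtain N :: nat where N: "\<bar>y0 $ first_idx\<bar> < real N" using reals_Archimedean2 by blast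
  define V' where "V' = V \<inter> {y. \<bar>y $ first_idx\<bar> < real N}"
  have oV': "open V'"
    unfolding V'_def by (intro open_Int V open_Collect_less continuous_intros)
  have "y0 \<in> V'" using y0 N by (simp add: V'_def)
  show thesis
  proof (rule that[of "V' - B N"])
    show "open (V' - B N)" using oV' cB by (rule open_Diff)
    show "V' - B N \<noteq> {}"
    proof
      assume "V' - B N = {}"
      then have "V' \<subseteq> interior (B N)" using oV' by (intro interior_maximal) auto
      with iB \<open>y0 \<in> V'\<close> show False by auto
    qed
    show "V' - B N \<subseteq> V" by (auto simp: V'_def)
    fix y assume y: "y \<in> V' - B N"
    have "y \<notin> shiftG G m \<and> - y \<notin> shiftG G m" if m: "m \<ge> 1" for m
    proof (cases "m \<le> N")
      case True
      with m have "shiftG G m \<union> uminus ` shiftG G m \<subseteq> B N"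
        unfolding B_def by (intro UN_upper) simp
      with y show ?thesis by (metis DiffD2 UnI1 UnI2 minus_minus image_eqI subsetD)
    next
      case False
      have yN: "\<bar>y $ first_idx\<bar> < real N" using y by (simp add: V'_def)
      have "z \<notin> shiftG G m" if "\<bar>z $ first_idx\<bar> < real N" for z
      proof
        assume "z \<in> shiftG G m"
        then have "2 * real m \<le> z $ first_idx" using shiftG_bounds[OF cube] by auto
        moreover have "real N < real m" using False by simp
        ultimately show False using that by linarith
      qed
      from this[of y] this[of "- y"] yN show ?thesis by simp
    qed
    then show "weight G b y = 1" by (auto simp: weight_def weight_pos_outside)
  qed
qed

lemma weight_shiftG:
  assumes cube: "\<forall>x\<in>G. \<forall>i. 0 \<le> x $ i \<and> x $ i \<le> 1" and y: "m \<ge> 1" "y \<in> shiftG G m"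
  shows "weight G b y = b m"
  using weight_pos_shiftG[OF assms] shiftG_bounds[OF cube y(2)] by (simp add: weight_def)

text \<open>In this gap between consecutive copies the Gaussian average of an indicator function
  will be tested at full weight.\<close>

lemma weight_between_shifts:
  assumes cube: "\<forall>x\<in>G. \<forall>i. 0 \<le> x $ i \<and> x $ i \<le> 1"
    and y: "2 * real m + 1 < y $ first_idx" "y $ first_idx < 2 * real m + 2"
  shows "weight G b y = 1"
proof -
  have "y \<notin> shiftG G k" for k
  proof
    assume "y \<in> shiftG G k"
    then have "2 * real k \<le> y $ first_idx" "y $ first_idx \<le> 2 * real k + 1"
      using shiftG_bounds[OF cube] by auto
    then have "real k < real (Suc m)" "real m < real k" using y by auto
    then show False by simp
  qed
  then show ?thesis using y by (simp add: weight_def weight_pos_outside)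
qed

section \<open>The weighted norm\<close>

lemma Linf_w_norm_le:
  assumes [measurable]: "f \<in> borel_measurable lebesgue" "w \<in> borel_measurable borel"
    and le: "\<And>x. norm (f x) * \<bar>w x\<bar> \<le> M"
  shows "Linf_w_norm w f \<le> ereal M"
proof -
  have [measurable]: "w \<in> borel_measurable lebesgue" by (rule measurable_completion) simp
  show ?thesis
    unfolding Linf_w_norm_def by (rule esssup_I) (auto simp: norm_mult le)
qed

text \<open>By continuity the set where \<open>norm (u y)\<close> exceeds \<open>r\<close> is open,
  so it contains a nonempty open set on which the weight is 1. The argument breaks down for
  indicator functions of the copies.\<close>

lemma norm_le_Linf_w_norm_weight:
  fixes G :: "(real^'n::{finite,wellorder}) set"
  assumes G: "compact G" "interior G = {}" and cube: "\<forall>x\<in>G. \<forall>i. 0 \<le> x $ i \<and> x $ i \<le> 1"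
    and u: "continuous_on UNIV u"
  shows "ereal (norm (u x)) \<le> Linf_w_norm (weight G b) u"
proof (rule ccontr)
  assume "\<not> ?thesis"
  then have "Linf_w_norm (weight G b) u < ereal (norm (u x))" by simp
  then obtain r where r: "Linf_w_norm (weight G b) u < ereal r" "ereal r < ereal (norm (u x))"
    using ereal_dense2 by blast
  let ?V = "{y. r < norm (u y)}"
  have "open ?V" by (intro open_Collect_less continuous_intros u)
  moreover have "?V \<noteq> {}" using r by auto
  ultimately obtain W where W: "open W" "W \<noteq> {}" "W \<subseteq> ?V" "\<And>y. y \<in> W \<Longrightarrow> weight G b y = 1"
    using weight_dense_eq_1[OF G cube] by metis
  have "ereal r \<le> Linf_w_norm (weight G b) u"
    unfolding Linf_w_norm_def
  proof (rule ereal_le_esssup_lebesgue[OF W(1,2)], rule AE_I2, rule impI)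
    fix y assume "y \<in> W"
    then show "ereal r \<le> ereal (norm (u y * complex_of_real (weight G b y)))"
      using W(3) W(4)[of y] by auto
  qed
  with r show False by simp
qed

section \<open>Schwartz functions\<close>

text \<open>The second conjunct is what allows repeated differentiation: directional derivatives
  stay polynomial, so products of a polynomial and the Gaussian are closed under partial
  derivatives.\<close>

lemma real_polynomial_function_has_derivative:
  assumes "real_polynomial_function p"
  shows "\<exists>p'. (\<forall>x. (p has_derivative p' x) (at x)) \<and> (\<forall>v. real_polynomial_function (\<lambda>x. p' x v))"
  using assms
proof induction
  case (linear f)
  then show ?case
    by (intro exI[of _ "\<lambda>_. f"]) (auto intro: bounded_linear_imp_has_derivative)
next
  case (const c)
  show ?case
    by (intro exI[of _ "\<lambda>_ _. 0"]) auto
next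
  case (add f g)
  then obtain f' g' where *: "\<And>x. (f has_derivative f' x) (at x)" "\<And>v. real_polynomial_function (\<lambda>x. f' x v)"
    "\<And>x. (g has_derivative g' x) (at x)" "\<And>v. real_polynomial_function (\<lambda>x. g' x v)" by blast
  show ?case
    by (intro exI[of _ "\<lambda>x v. f' x v + g' x v"] conjI allI has_derivative_add real_polynomial_function.intros(3) *)
next
  case (mult f g)
  then obtain f' g' where *: "\<And>x. (f has_derivative f' x) (at x)" "\<And>v. real_polynomial_function (\<lambda>x. f' x v)"
    "\<And>x. (g has_derivative g' x) (at x)" "\<And>v. real_polynomial_function (\<lambda>x. g' x v)" by blast
  show ?case
    by (intro exI[of _ "\<lambda>x v. f x * g' x v + f' x v * g x"] conjI allI has_derivative_mult
        real_polynomial_function.intros(3) real_polynomial_function.intros(4) * mult)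
qed

lemma real_polynomial_function_growth:
  assumes "real_polynomial_function p"
  shows "\<exists>C N. C \<ge> 0 \<and> (\<forall>x. \<bar>p x\<bar> \<le> C * (1 + norm x) ^ N)"
  using assms
proof induction
  case (linear f)
  then obtain K where K: "K > 0" "\<And>x. norm (f x) \<le> norm x * K"
    using bounded_linear.pos_bounded by blast
  have "\<bar>f x\<bar> \<le> K * (1 + norm x) ^ 1" for x
    using K(2)[of x] K(1) by (simp add: distrib_left mult.commute)
  with K(1) show ?case by (intro exI[of _ K] exI[of _ 1]) auto
next
  case (const c)
  show ?case by (intro exI[of _ "\<bar>c\<bar>"] exI[of _ 0]) auto
next
  case (add f g)
  then obtain C N D M where *: "C \<ge> 0" "\<And>x. \<bar>f x\<bar> \<le> C * (1 + norm x) ^ N"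
     "D \<ge> 0" "\<And>x. \<bar>g x\<bar> \<le> D * (1 + norm x) ^ M" by blast
  have "\<bar>f x + g x\<bar> \<le> (C + D) * (1 + norm x) ^ (N + M)" for x
  proof -
    have "\<bar>f x\<bar> \<le> C * (1 + norm x) ^ (N + M)"
      using *(1) by (intro order_trans[OF *(2)[of x]] mult_left_mono power_increasing) auto
    moreover have "\<bar>g x\<bar> \<le> D * (1 + norm x) ^ (N + M)"
      using *(3) by (intro order_trans[OF *(4)[of x]] mult_left_mono power_increasing) auto
    ultimately show ?thesis unfolding distrib_right by linarith
  qed
  with * show ?case by (intro exI[of _ "C + D"] exI[of _ "N + M"]) auto
next
  case (mult f g)
  then obtain C N D M where *: "C \<ge> 0" "\<And>x. \<bar>f x\<bar> \<le> C * (1 + norm x) ^ N"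
     "D \<ge> 0" "\<And>x. \<bar>g x\<bar> \<le> D * (1 + norm x) ^ M" by blast
  have "\<bar>f x * g x\<bar> \<le> (C * D) * (1 + norm x) ^ (N + M)" for x
  proof -
    have "\<bar>f x\<bar> * \<bar>g x\<bar> \<le> (C * (1 + norm x) ^ N) * (D * (1 + norm x) ^ M)"
      using * by (intro mult_mono) auto
    then show ?thesis by (simp add: abs_mult power_add mult_ac)
  qed
  with * show ?case by (intro exI[of _ "C * D"] exI[of _ "N + M"]) auto
qed

lemma power_le_fact_mult_exp: "0 \<le> y \<Longrightarrow> y ^ n \<le> fact n * exp (y::real)"
proof -
  assume y: "0 \<le> y"
  have s: "summable (\<lambda>k. y ^ k / fact k)"
    using summable_exp[of y] by (simp add: field_simps)
  have "(\<Sum>k\<in>{n}. y ^ k / fact k) \<le> (\<Sum>k. y ^ k / fact k)"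
    by (rule sum_le_suminf[OF s]) (use y in auto)
  also have "\<dots> = exp y" by (simp add: exp_def field_simps)
  finally show ?thesis by (simp add: field_simps)
qed

lemma power_mult_gauss_le:
  "(1 + norm x) ^ N * gauss 1 x \<le> 4 ^ N * fact N * exp (1 / 2)"
proof -
  \<comment> \<open>With this \<open>y\<close>, \<open>(1 + norm x)\<^sup>2\<close> is at most
    \<open>4 * y\<close>, and \<open>gauss 1 x\<close> equals \<open>exp (1 / 2 - y)\<close>, so the
    exponentials cancel up to \<open>exp (1 / 2)\<close>.\<close>
  define y where "y = 1 / 2 + (norm x)\<^sup>2 / 2"
  have y0: "y \<ge> 0" unfolding y_def by (intro add_nonneg_nonneg) auto
  have "(1 + norm x) ^ N \<le> ((1 + norm x) ^ 2) ^ N"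
    unfolding power_mult[symmetric] by (intro power_increasing) auto
  also have "\<dots> \<le> (4 * y) ^ N"
  proof (rule power_mono)
    show "(1 + norm x)\<^sup>2 \<le> 4 * y"
      using sum_squares_bound[of 1 "norm x"] unfolding y_def by (simp add: power2_sum)
  qed simp
  also have "\<dots> = 4 ^ N * y ^ N" by (rule power_mult_distrib)
  also have "\<dots> \<le> 4 ^ N * (fact N * exp y)"
    using power_le_fact_mult_exp[OF y0, of N] by (intro mult_left_mono) auto
  finally have "(1 + norm x) ^ N * gauss 1 x \<le> 4 ^ N * (fact N * exp y) * gauss 1 x"
    by (rule mult_right_mono) simp
  also have "\<dots> = 4 ^ N * fact N * exp (1 / 2)"
    by (simp add: gauss_def y_def flip: exp_add)
  finally show ?thesis .
qed

lemma has_derivative_gauss: "(gauss 1 has_derivative (\<lambda>h. - (x \<bullet> h) * gauss 1 x)) (at x)"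
  unfolding gauss_def[abs_def] power2_norm_eq_inner
  by (auto intro!: derivative_eq_intros simp: inner_commute)

text \<open>A partial derivative in direction \<open>i\<close> replaces the polynomial factor
  \<open>p\<close> by its own partial derivative minus the \<open>i\<close>-th coordinate times
  \<open>p\<close>, as for Hermite polynomials.\<close>

lemma iter_partial_gaussian:
  "\<exists>p. real_polynomial_function p \<and>
    iter_partial is (\<lambda>x::real^'n. complex_of_real (gauss 1 x)) = (\<lambda>x. complex_of_real (p x * gauss 1 x))"
proof (induction "is")
  case Nil
  show ?case by (intro exI[of _ "\<lambda>_. 1"]) auto
next
  case (Cons i "is")
  then obtain p :: "real^'n \<Rightarrow> real" where p: "real_polynomial_function p"
    "iter_partial is (\<lambda>x. complex_of_real (gauss 1 x)) = (\<lambda>x. complex_of_real (p x * gauss 1 x))" by blast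
  from real_polynomial_function_has_derivative[OF p(1)] obtain p' where
    p': "\<And>x. (p has_derivative p' x) (at x)" "\<And>v. real_polynomial_function (\<lambda>x. p' x v)" by blast
  have lin: "real_polynomial_function (\<lambda>x. - (x \<bullet> v))" for v :: "real^'n"
    by (intro real_polynomial_function_minus real_polynomial_function.intros(1) bounded_linear_inner_left)
  have "((\<lambda>x. complex_of_real (p x * gauss 1 x)) has_derivative
      (\<lambda>h. complex_of_real (p x * (- (x \<bullet> h) * gauss 1 x) + p' x h * gauss 1 x))) (at x)" for x
    by (intro has_derivative_of_real has_derivative_mult p' has_derivative_gauss)
  from fun_cong[OF frechet_derivative_at[OF this], symmetric]
  have "iter_partial (i # is) (\<lambda>x. complex_of_real (gauss 1 x))
      = (\<lambda>x. complex_of_real (p x * (- (x \<bullet> axis i 1) * gauss 1 x) + p' x (axis i 1) * gauss 1 x))"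
    by (simp only: iter_partial.simps p(2) partial_dir_def fun_eq_iff simp_thms)
  then have "iter_partial (i # is) (\<lambda>x. complex_of_real (gauss 1 x))
      = (\<lambda>x. complex_of_real ((p x * (- (x \<bullet> axis i 1)) + p' x (axis i 1)) * gauss 1 x))"
    by (simp only: distrib_right mult.assoc)
  then show ?case
    by (intro exI[of _ "\<lambda>x. p x * (- (x \<bullet> axis i 1)) + p' x (axis i 1)"] conjI
        real_polynomial_function.intros(3) real_polynomial_function.intros(4) p p' lin)
qed

lemma gaussian_in_schwartz: "(\<lambda>x::real^'n. complex_of_real (gauss 1 x)) \<in> schwartz"
  unfolding schwartz_def mem_Collect_eq
proof (intro conjI allI)
  fix "is" :: "'n list" and x :: "real^'n" and k :: nat
  obtain p :: "real^'n \<Rightarrow> real" where p: "real_polynomial_function p"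
    "iter_partial is (\<lambda>x. complex_of_real (gauss 1 x)) = (\<lambda>x. complex_of_real (p x * gauss 1 x))"
    using iter_partial_gaussian by blast
  from real_polynomial_function_has_derivative[OF p(1)] obtain p' where
    p': "\<And>x. (p has_derivative p' x) (at x)" by blast
  have "((\<lambda>x. complex_of_real (p x * gauss 1 x)) has_derivative
      (\<lambda>h. complex_of_real (p x * (- (x \<bullet> h) * gauss 1 x) + p' x h * gauss 1 x))) (at x)"
    by (intro has_derivative_of_real has_derivative_mult p' has_derivative_gauss)
  then show "iter_partial is (\<lambda>x. complex_of_real (gauss 1 x)) differentiable (at x)"
    unfolding p(2) by (rule differentiableI)
  obtain C N where C: "C \<ge> 0" "\<And>x. \<bar>p x\<bar> \<le> C * (1 + norm x) ^ N"
    using real_polynomial_function_growth[OF p(1)] by blast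
  have "norm ((1 + norm x) ^ k * norm (complex_of_real (p x * gauss 1 x)))
      \<le> C * (4 ^ (k + N) * fact (k + N) * exp (1 / 2))" for x
  proof -
    have "norm ((1 + norm x) ^ k * norm (complex_of_real (p x * gauss 1 x)))
        = (1 + norm x) ^ k * (\<bar>p x\<bar> * gauss 1 x)"
      by (simp add: norm_mult abs_mult)
    also have "\<dots> \<le> (1 + norm x) ^ k * ((C * (1 + norm x) ^ N) * gauss 1 x)"
      by (intro mult_left_mono mult_right_mono C) auto
    also have "\<dots> = C * ((1 + norm x) ^ (k + N) * gauss 1 x)"
      by (simp add: power_add)
    also have "\<dots> \<le> C * (4 ^ (k + N) * fact (k + N) * exp (1 / 2))"
      by (intro mult_left_mono power_mult_gauss_le C)
    finally show ?thesis .
  qed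
  then show "bounded (range (\<lambda>x. (1 + norm x) ^ k * norm (iter_partial is (\<lambda>x. complex_of_real (gauss 1 x)) x)))"
    unfolding p(2) by (intro boundedI) auto
qed

section \<open>Continuity and integrability of Schwartz functions\<close>

lemma continuous_on_schwartz: "u \<in> schwartz \<Longrightarrow> continuous_on UNIV u"
proof -
  assume "u \<in> schwartz"
  then have "iter_partial [] u differentiable (at x)" for x unfolding schwartz_def by blast
  then show ?thesis
    by (auto intro!: continuous_at_imp_continuous_on differentiable_imp_continuous_within)
qed

lemma integrable_inverse_one_plus_square: "integrable lborel (\<lambda>x::real. inverse (1 + x\<^sup>2))"
  using integrable_inverse_1_plus_square by (simp add: set_integrable_def einterval_def)

text \<open>The majorant is a tensor product of the functions
  \<open>inverse (1 + x\<^sup>2)\<close>. Each denominator is at most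
  \<open>(1 + norm x)\<^sup>2\<close>, which explains the decay exponent of twice the
  dimension.\<close>

lemma integrable_schwartz:
  fixes u :: "real^'n \<Rightarrow> complex"
  assumes u: "u \<in> schwartz"
  shows "integrable lborel u"
proof -
  let ?k = "2 * DIM(real^'n)"
  have [measurable]: "u \<in> borel_measurable borel"
    by (intro borel_measurable_continuous_onI continuous_on_schwartz u)
  have "bounded (range (\<lambda>x. (1 + norm x) ^ ?k * norm (iter_partial [] u x)))"
    using u unfolding schwartz_def by blast
  then obtain M where M: "\<And>x. (1 + norm x) ^ ?k * norm (u x) \<le> M"
    unfolding bounded_iff by auto
  let ?h = "\<lambda>x::real^'n. \<Prod>b\<in>Basis. inverse (1 + (x \<bullet> b)\<^sup>2)"
  have h: "integrable lborel ?h"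
    by (rule integrable_lborel_prod) (rule integrable_inverse_one_plus_square)
  have "norm (u x) \<le> M * ?h x" for x
  proof -
    have pos: "0 < (\<Prod>b\<in>Basis. 1 + (x \<bullet> b)\<^sup>2)"
      by (intro prod_pos) (auto intro: add_pos_nonneg)
    have "(\<Prod>b\<in>Basis. 1 + (x \<bullet> b)\<^sup>2) \<le> (\<Prod>b\<in>(Basis :: (real^'n) set). (1 + norm x)\<^sup>2)"
    proof (intro prod_mono conjI)
      fix b :: "real^'n" assume b: "b \<in> Basis"
      have "\<bar>x \<bullet> b\<bar>\<^sup>2 \<le> (norm x)\<^sup>2"
        by (intro power_mono Basis_le_norm b) simp
      then show "1 + (x \<bullet> b)\<^sup>2 \<le> (1 + norm x)\<^sup>2"
        by (simp add: power2_sum add_increasing2)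
    qed (simp add: add_nonneg_nonneg)
    also have "\<dots> = (1 + norm x) ^ ?k"
      unfolding prod_constant power_mult ..
    finally have "(\<Prod>b\<in>Basis. 1 + (x \<bullet> b)\<^sup>2) * norm (u x) \<le> (1 + norm x) ^ ?k * norm (u x)"
      by (rule mult_right_mono) simp
    also note M
    finally show ?thesis
      unfolding prod_inversef[unfolded comp_def] using pos by (simp add: field_simps)
  qed
  then show ?thesis
    by (intro Bochner_Integration.integrable_bound[OF integrable_mult_right[OF h, of M]] AE_I2)
       (auto intro: order_trans[OF _ abs_ge_self])
qed

section \<open>The Gaussian multiplier\<close>

text \<open>The constant is 1: the weighted norm of \<open>u\<close> bounds \<open>u\<close>
  everywhere, averaging keeps the bound, and a weight of at most 1 cannot raise it.\<close>

lemma gaussian_in_mult_Linf_w_weight: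
  fixes G :: "(real^'n::{finite,wellorder}) set"
  assumes G: "compact G" "interior G = {}" and cube: "\<forall>x\<in>G. \<forall>i. 0 \<le> x $ i \<and> x $ i \<le> 1"
    and b: "\<forall>m\<ge>1. 0 < b m \<and> b m < 1"
  shows "gaussian \<in> mult_Linf_w (weight G b)"
proof -
  let ?w = "weight G b"
  have "Linf_w_norm ?w (inv_fourier (\<lambda>\<xi>. gaussian \<xi> * fourier u \<xi>)) \<le> ereal 1 * Linf_w_norm ?w u"
    if u: "u \<in> schwartz \<inter> Linf_w ?w" for u :: "(real, 'n) vec \<Rightarrow> complex"
  proof -
    have cont: "continuous_on UNIV u" using u by (intro continuous_on_schwartz) simp
    then have [measurable]: "u \<in> borel_measurable borel" by (rule borel_measurable_continuous_onI)
    have le: "ereal (norm (u x)) \<le> Linf_w_norm ?w u" for x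
      by (rule norm_le_Linf_w_norm_weight[OF G cube cont])
    have "Linf_w_norm ?w u < \<infinity>" using u by (simp add: Linf_w_def)
    moreover have "0 \<le> Linf_w_norm ?w u" using order_trans[OF _ le[of 0]] by simp
    ultimately obtain M where M: "Linf_w_norm ?w u = ereal M" by (cases "Linf_w_norm ?w u") auto
    have "Linf_w_norm ?w (gauss_conv u) \<le> ereal M"
    proof (rule Linf_w_norm_le)
      show "gauss_conv u \<in> borel_measurable lebesgue"
        by (intro measurable_completion) (simp add: borel_measurable_gauss_conv)
      show "?w \<in> borel_measurable borel" by (rule borel_measurable_weight[OF G(1) cube])
      fix x
      have "norm (gauss_conv u x) * \<bar>?w x\<bar> \<le> norm (gauss_conv u x) * 1"
        using weight_bounds[OF b, of G x] by (intro mult_left_mono) auto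
      also have "\<dots> \<le> M"
        using le M by (simp add: norm_gauss_conv_le)
      finally show "norm (gauss_conv u x) * \<bar>?w x\<bar> \<le> M" .
    qed
    with M show ?thesis
      using u by (simp add: inv_fourier_gaussian_fourier integrable_schwartz)
  qed
  then show ?thesis unfolding mult_Linf_w_def by blast
qed

lemma gaussian_notin_mult0_Linf_w_weight:
  fixes G :: "(real^'n::{finite,wellorder}) set"
  assumes G: "compact G" "emeasure lebesgue G > 0" and cube: "\<forall>x\<in>G. \<forall>i. 0 \<le> x $ i \<and> x $ i \<le> 1"
    and b: "\<forall>m\<ge>1. 0 < b m \<and> b m < 1" "b \<longlonglongrightarrow> 0"
  shows "gaussian \<notin> mult0_Linf_w (weight G b)"
proof
  let ?w = "weight G b"
  assume "gaussian \<in> mult0_Linf_w ?w"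
  then obtain C where C: "\<And>u. u \<in> L2 \<inter> Linf_w ?w \<Longrightarrow> Linf_w_norm ?w u \<noteq> 0 \<Longrightarrow>
      Linf_w_norm ?w (inv_fourier_L2 (\<lambda>\<xi>. gaussian \<xi> * fourier_L2 u \<xi>)) \<le> ereal C * Linf_w_norm ?w u"
    unfolding mult0_Linf_w_def by blast
  obtain R where R: "\<And>z. z \<in> G \<Longrightarrow> norm z \<le> R"
    using compact_imp_bounded[OF G(1)] unfolding bounded_iff by blast
  \<comment> \<open>Every point of the test ball is within \<open>2 + R\<close> of every point of
    the copy: radius 1/2, offset 3/2 of the centre, and at most \<open>R\<close> for a point of
    \<open>G\<close>.\<close>
  define c where "c = (2 * pi) powr (- (real CARD('n) / 2)) * (exp (- (2 + R)\<^sup>2 / 2) * measure lebesgue G)"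
  have "measure lebesgue G > 0"
    using G by (simp add: emeasure_eq_measure2[OF lmeasurable_compact] )
  then have c: "c > 0" unfolding c_def by simp
  have wm[measurable]: "?w \<in> borel_measurable borel" by (rule borel_measurable_weight[OF G(1) cube])
  have "c \<le> \<bar>C\<bar> * b m" if m: "m \<ge> 1" for m
  proof -
    let ?S = "shiftG G m"
    define u where "u = (\<lambda>y. complex_of_real (indicator ?S y))"
    define p where "p = (axis first_idx (2 * real m) :: (real, 'n) vec)"
    have S: "compact ?S" using G(1) unfolding shiftG_eq by (rule compact_translation)
    then have [measurable]: "?S \<in> sets borel" by (intro borel_closed compact_imp_closed)
    have Sfin: "emeasure lborel ?S < \<infinity>" using S by (rule emeasure_compact_finite)
    have Smeas: "measure lborel ?S = measure lebesgue G"
    proof -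
      have "measure lborel ?S = measure lebesgue ?S"
        by (rule measure_completion[symmetric]) simp
      then show ?thesis by (simp only: shiftG_eq measure_translation)
    qed
    have um[measurable]: "u \<in> borel_measurable borel" unfolding u_def by measurable
    have uml: "u \<in> borel_measurable lebesgue" by (rule measurable_completion) simp
    have u1: "integrable lborel u" unfolding u_def using Sfin by simp
    have "(\<lambda>x. (norm (u x))\<^sup>2) = indicator ?S" unfolding u_def by (auto simp: indicator_def)
    then have u2: "integrable lborel (\<lambda>x. (norm (u x))\<^sup>2)" using Sfin by simp
    have "u \<in> L2" unfolding L2_def using u2 uml by (simp add: integrable_completion)
    have b0: "b m > 0" using b(1) m by blast
    have uw: "norm (u x) * \<bar>?w x\<bar> = (if x \<in> ?S then b m else 0)" for x
      using weight_shiftG[OF cube m, of x b] b0 by (simp add: u_def)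
    have le: "Linf_w_norm ?w u \<le> ereal (b m)"
      by (rule Linf_w_norm_le[OF uml wm]) (use uw b0 in simp)
    \<comment> \<open>The multiplier estimate speaks only of functions of nonzero norm; positive
      measure of \<open>G\<close> and \<open>b m > 0\<close> ensure this.\<close>
    have ge: "Linf_w_norm ?w u > 0"
    proof (rule ccontr)
      assume "\<not> ?thesis"
      then have "esssup lebesgue (\<lambda>x. ereal (norm (u x * complex_of_real (?w x)))) \<le> 0"
        by (simp add: Linf_w_norm_def)
      then have "AE x in lebesgue. ereal (norm (u x * complex_of_real (?w x))) \<le> 0"
        by (intro eventually_mono[OF esssup_AE]) (rule order_trans)
      then have "AE x in lebesgue. x \<notin> ?S"
      proof eventually_elim
        case (elim x)
        then show ?case using uw[of x] b0 by (auto simp: norm_mult)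
      qed
      then have "?S \<in> null_sets lebesgue"
        by (simp add: AE_iff_null_sets)
      then have "measure lebesgue ?S = 0" by (simp add: measure_def null_setsD1)
      then show False using Smeas \<open>measure lebesgue G > 0\<close> by simp
    qed
    from le ge obtain L where L: "Linf_w_norm ?w u = ereal L" "0 < L" "L \<le> b m"
      by (cases "Linf_w_norm ?w u") auto
    have "u \<in> Linf_w ?w" using uml L by (simp add: Linf_w_def)
    then have "Linf_w_norm ?w (inv_fourier_L2 (\<lambda>\<xi>. gaussian \<xi> * fourier_L2 u \<xi>)) \<le> ereal (C * L)"
      using C[of u] \<open>u \<in> L2\<close> L by simp
    moreover have "ereal c \<le> Linf_w_norm ?w (inv_fourier_L2 (\<lambda>\<xi>. gaussian \<xi> * fourier_L2 u \<xi>))"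
      unfolding Linf_w_norm_def
    proof (rule ereal_le_esssup_lebesgue)
      \<comment> \<open>The first coordinates of this ball lie strictly between
        \<open>2 * m + 1\<close> and \<open>2 * m + 2\<close>, so the weight is 1 on it.\<close>
      let ?W = "ball (p + axis first_idx (3 / 2)) (1 / 2)"
      show "open ?W" "?W \<noteq> {}" by auto
      obtain R0 where R0: "\<And>x. x \<in> ?S \<Longrightarrow> norm x < R0"
        using compact_imp_bounded[OF S] unfolding bounded_pos_less by blast
      have "AE x in lebesgue. inv_fourier_L2 (\<lambda>\<xi>. gaussian \<xi> * fourier_L2 u \<xi>) x = gauss_conv u x"
        by (rule inv_fourier_L2_gaussian_fourier_L2(2)[OF u1 u2, of R0]) (use R0 in \<open>force simp: u_def indicator_def\<close>)
      then show "AE x in lebesgue. x \<in> ?W \<longrightarrow>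
        ereal c \<le> ereal (norm (inv_fourier_L2 (\<lambda>\<xi>. gaussian \<xi> * fourier_L2 u \<xi>) x * complex_of_real (?w x)))"
      proof eventually_elim
        case (elim x)
        show ?case
        proof
          assume x: "x \<in> ?W"
          then have d: "norm (x - (p + axis first_idx (3 / 2))) < 1 / 2"
            by (simp add: dist_norm norm_minus_commute)
          have "\<bar>(x - (p + axis first_idx (3 / 2))) $ first_idx\<bar> < 1 / 2"
            by (rule le_less_trans[OF component_le_norm_cart d])
          then have "\<bar>x $ first_idx - (2 * real m + 3 / 2)\<bar> < 1 / 2"
            by (simp add: p_def axis_def)
          then have w1: "?w x = 1"
            by (intro weight_between_shifts[OF cube, of m]) linarith+
          have "c \<le> norm (gauss_conv u x)"
            unfolding c_def u_def Smeas[symmetric]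
          proof (rule gauss_conv_indicator_ge)
            fix y assume "y \<in> ?S"
            then obtain z where z: "z \<in> G" "y = p + z" by (auto simp: shiftG_eq p_def)
            have "x - y = (x - (p + axis first_idx (3 / 2))) + (axis first_idx (3 / 2) - z)"
              by (simp add: z(2))
            also have "norm \<dots> \<le> norm (x - (p + axis first_idx (3 / 2))) + (norm (axis first_idx (3 / 2) :: (real, 'n) vec) + norm z)"
              by (intro order_trans[OF norm_triangle_ineq] add_left_mono norm_triangle_ineq4)
            also have "\<dots> \<le> 2 + R"
            proof -
              have "axis first_idx (3 / 2) = (3 / 2) *\<^sub>R (axis first_idx 1 :: (real, 'n) vec)"
                by (simp add: axis_def vec_eq_iff)
              then have "norm (axis first_idx (3 / 2) :: (real, 'n) vec) = 3 / 2"
                by simp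
              then show ?thesis using d R[OF z(1)] by simp
            qed
            finally show "norm (x - y) \<le> 2 + R" .
          qed (use Sfin in auto)
          with elim w1 show "ereal c \<le> ereal (norm (inv_fourier_L2 (\<lambda>\<xi>. gaussian \<xi> * fourier_L2 u \<xi>) x * complex_of_real (?w x)))"
            by simp
        qed
      qed
    qed
    ultimately have "ereal c \<le> ereal (C * L)" by (rule order_trans[rotated])
    then have "c \<le> C * L" by simp
    \<comment> \<open>The absolute value is taken because the constant supplied by
      \<open>mult0_Linf_w\<close> has no prescribed sign.\<close>
    also have "\<dots> \<le> \<bar>C\<bar> * b m"
      using L by (intro mult_mono) auto
    finally show ?thesis .
  qed
  then have "\<forall>\<^sub>F m in sequentially. c \<le> \<bar>C\<bar> * b m"
    by (auto intro: eventually_sequentiallyI[of 1])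
  moreover have "(\<lambda>m. \<bar>C\<bar> * b m) \<longlonglongrightarrow> \<bar>C\<bar> * 0"
    by (intro tendsto_intros b(2))
  ultimately have "c \<le> \<bar>C\<bar> * 0"
    using tendsto_lowerbound by (metis sequentially_bot)
  with c show False by simp
qed

theorem theorem6p2:
  fixes G :: "(real^'n::{finite,wellorder}) set" and b :: "nat \<Rightarrow> real"
  assumes "compact G"
    and "\<forall>x\<in>G. \<forall>i. 0 \<le> x $ i \<and> x $ i \<le> 1"
    and "emeasure lebesgue G > 0"
    and "interior G = {}"
    and "\<forall>m\<ge>1. 0 < b m \<and> b m < 1"
    and "b \<longlonglongrightarrow> 0"
  shows "\<exists>a\<in>schwartz. a \<in> mult_Linf_w (weight G b) \<and> a \<notin> mult0_Linf_w (weight G b)"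
  using gaussian_in_schwartz gaussian_in_mult_Linf_w_weight[OF assms(1,4,2,5)]
    gaussian_notin_mult0_Linf_w_weight[OF assms(1,3,2,5,6)] by blast

end
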